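(* Let $f, g \in \mathbf{PU}(2,1)$ be elliptic elements of finite orders $m$ and $n$ respectively. Suppose that one of the following holds: (1) $f$ and $g$ are complex reflections in complex lines; (2) $f$ is a complex reflection in a complex line and $g$ is a complex reflection in a point; (3) $f$ and $g$ are complex reflections in points. Let $\delta(f,g)$ be the distance in complex hyperbolic space $\mathbf{H}^2_{\mathbf{C}}$ between the complex lines or points fixed by $f$ and $g$. If $$\cosh\delta(f,g) > \frac{\cos\frac{\pi}{m}\cos\frac{\pi}{n}+1}{\sin\frac{\pi}{m}\sin\frac{\pi}{n}},$$ then the subgroup $\langle f,g\rangle$ of $\mathbf{PU}(2,1)$ is discrete and isomorphic to the free product $\langle f\rangle * \langle g\rangle$.
   Context: Let $\mathbf{C}^{2,1}$ be $\mathbf{C}^3$ equipped with the Hermitian form $\langle \mathbf{z},\mathbf{w}\rangle = \mathbf{w}^* J \mathbf{z}$ of signature $(2,1)$, where $J=\begin{bmatrix}0&0&1\\0&1&0\\1&0&0\end{bmatrix}$. A vector $\mathbf{v}$ is called positive or negative if $\langle\mathbf{v},\mathbf{v}\rangle>0$ or $<0$ respectively. Complex hyperbolic space $\mathbf{H}^2_{\mathbf{C}}$ is the image in complex projective space of the set of negative vectors, with the Bergman metric $\rho$ normalized by $$\cosh^2\left(\frac{\rho(z,w)}{2}\right)=\frac{\langle\mathbf{z},\mathbf{w}\rangle\langle\mathbf{w},\mathbf{z}\rangle}{\langle\mathbf{z},\mathbf{z}\rangle\langle\mathbf{w},\mathbf{w}\rangle},$$ where $\mathbf{z},\mathbf{w}$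 are any negative vectors representing the points $z,w$. $\mathbf{PU}(2,1)$ is the projective unitary group of this form (the group of linear maps preserving the form, modulo scalars); it acts on $\mathbf{H}^2_{\mathbf{C}}$ by holomorphic isometries. Discreteness refers to its Lie group topology. A complex line in $\mathbf{H}^2_{\mathbf{C}}$ is the nonempty intersection of $\mathbf{H}^2_{\mathbf{C}}$ with the projectivization of a two-dimensional complex linear subspace of $\mathbf{C}^{2,1}$. An element of $\mathbf{PU}(2,1)$ is elliptic if it fixes at least one point of $\mathbf{H}^2_{\mathbf{C}}$. A non-identity elliptic element is a complex reflection in a complex line $L$ if a matrix representing it has a repeated eigenvalue whose eigenspace is two-dimensional and contains both positive and negative vectors, $L$ being the complex line given by this eigenspace; it then fixes $L$ pointwise. A non-identity elliptic element is a complex reflection in a point $w\in\mathbf{H}^2_{\mathbf{C}}$ if a matrix representing it has a one-dimensional eigenspace spanned by a negative vector representing $w$, and a repeated eigenvalue with two-dimensional eigenspace spanned by two positive vectors (the orthogonal complement of the negative eigenvector); it then fixes $w$. The order of an elliptic element is the smallest positive integer $k$ such that its $k$-th power is the identity of $\mathbf{PU}(2,1)$; since the reflections are non-identity elements, $m,n\ge 2$. The distance between two subsets (complex lines or points) is the infimum of $\rho$ over pairs of points, one in each subset. *)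

theory Defs
  imports "HOL-Analysis.Analysis" "HOL-Algebra.Multiplicative_Group"
begin

section \<open>The Hermitian form of signature (2,1)\<close>

definition J21 :: "complex ^ 3 ^ 3" where
  "J21 = vector [vector [0, 0, 1], vector [0, 1, 0], vector [1, 0, 0]]"

definition herm :: "complex ^ 3 \<Rightarrow> complex ^ 3 \<Rightarrow> complex" where
  "herm z w = (\<Sum>i\<in>UNIV. cnj (w $ i) * (J21 *v z) $ i)"

text \<open>The number \<open>herm v v\<close> is always real, see \<open>herm_self_real\<close> below.\<close>

definition positive_vec :: "complex ^ 3 \<Rightarrow> bool" where
  "positive_vec v \<longleftrightarrow> Re (herm v v) > 0"

definition negative_vec :: "complex ^ 3 \<Rightarrow> bool" where
  "negative_vec v \<longleftrightarrow> Re (herm v v) < 0"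

lemma herm_expand:
  "herm z w = z $ 1 * cnj (w $ 3) + z $ 2 * cnj (w $ 2) + z $ 3 * cnj (w $ 1)"
  by (simp add: herm_def J21_def matrix_vector_mult_def sum_3 algebra_simps)

lemma herm_cnj: "cnj (herm z w) = herm w z"
  by (simp add: herm_expand algebra_simps)

lemma herm_self_real: "Im (herm v v) = 0"
  by (metis herm_cnj Reals_cnj_iff complex_is_Real_iff)

lemma herm_add_left: "herm (x + y) w = herm x w + herm y w"
  by (simp add: herm_expand algebra_simps)

lemma herm_diff_left: "herm (x - y) w = herm x w - herm y w"
  by (simp add: herm_expand algebra_simps)

lemma herm_scale_left: "herm (c *s x) w = c * herm x w"
  by (simp add: herm_expand algebra_simps)

lemma herm_add_right: "herm z (x + y) = herm z x + herm z y"
  by (simp add: herm_expand algebra_simps)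

lemma herm_diff_right: "herm z (x - y) = herm z x - herm z y"
  by (simp add: herm_expand algebra_simps)

lemma herm_scale_right: "herm z (c *s x) = cnj c * herm z x"
  by (simp add: herm_expand algebra_simps)

lemma herm_nondegenerate:
  assumes "\<And>w. herm z w = 0"
  shows "z = 0"
  using assms[of "axis 1 1"] assms[of "axis 2 1"] assms[of "axis 3 1"]
  by (simp add: herm_expand axis_def vec_eq_iff forall_3)


section \<open>Complex hyperbolic space\<close>

text \<open>Points of the complex projective plane are represented by one-dimensional complex
  linear subspaces of the space of column vectors.\<close>

type_synonym point = "(complex ^ 3) set"

definition HC2 :: "point set" where
  "HC2 = {vec.span {v} | v. negative_vec v}"

definition rho :: "point \<Rightarrow> point \<Rightarrow> real" where
  "rho x y = (THE r. 0 \<le> r \<and>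
     (\<forall>z\<in>x. \<forall>w\<in>y. negative_vec z \<longrightarrow> negative_vec w \<longrightarrow>
        complex_of_real ((cosh (r / 2))\<^sup>2) =
          herm z w * herm w z / (herm z z * herm w w)))"

definition set_rho :: "point set \<Rightarrow> point set \<Rightarrow> real" where
  "set_rho X Y = Inf {rho x y | x y. x \<in> X \<and> y \<in> Y}"

definition hyp_part :: "(complex ^ 3) set \<Rightarrow> point set" where
  "hyp_part V = {x \<in> HC2. x \<subseteq> V}"

definition complex_line :: "point set \<Rightarrow> bool" where
  "complex_line L \<longleftrightarrow>
     (\<exists>V. vec.subspace V \<and> vec.dim V = 2 \<and> L = hyp_part V \<and> L \<noteq> {})"

lemma herm_orthogonal_nonneg:
  assumes "negative_vec z" "herm v z = 0"
  shows "Re (herm v v) \<ge> 0"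
proof (rule ccontr)
  assume "\<not> ?thesis"
  hence vneg: "Re (herm v v) < 0" by simp
  define a where "a = v $ 1 - v $ 3"
  define b where "b = - (z $ 1 - z $ 3)"
  define x where "x = a *s z + b *s v"
  have zneg: "Re (herm z z) < 0" using assms(1) by (simp add: negative_vec_def)
  have self: "Re (herm y y) = 2 * Re (y $ 1 * cnj (y $ 3)) + (cmod (y $ 2))\<^sup>2" for y
    by (simp add: herm_expand cmod_power2) (simp add: power2_eq_square algebra_simps)
  have nn: "Re (herm y y) \<ge> 0" if "y $ 1 = y $ 3" for y
    unfolding self that by simp
  have "x $ 1 = x $ 3" by (simp add: x_def a_def b_def algebra_simps)
  hence "Re (herm x x) \<ge> 0" by (rule nn)
  moreover have "b \<noteq> 0" using nn[of z] zneg by (auto simp: b_def)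
  moreover have zv: "herm z v = 0" using assms(2) by (metis herm_cnj complex_cnj_zero)
  have "herm x x = a * cnj a * herm z z + b * cnj b * herm v v"
    by (simp add: x_def herm_add_left herm_add_right herm_scale_left herm_scale_right
        assms(2) zv algebra_simps)
  hence "Re (herm x x) = (cmod a)\<^sup>2 * Re (herm z z) + (cmod b)\<^sup>2 * Re (herm v v)"
    by (simp add: complex_norm_square[symmetric] del: of_real_power)
  moreover have "(cmod a)\<^sup>2 * Re (herm z z) \<le> 0"
    using zneg by (simp add: mult_nonneg_nonpos)
  moreover have "(cmod b)\<^sup>2 * Re (herm v v) < 0"
    using vneg \<open>b \<noteq> 0\<close> by (simp add: mult_pos_neg)
  ultimately show False by linarith
qed

lemma reverse_Cauchy_Schwarz:
  assumes "negative_vec z" "negative_vec w"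
  shows "Re (herm z z) * Re (herm w w) \<le> (cmod (herm z w))\<^sup>2"
proof -
  define N where "N = Re (herm z z)"
  have N: "herm z z = complex_of_real N" by (simp add: N_def complex_eq_iff herm_self_real)
  have Nneg: "N < 0" using assms(1) by (simp add: N_def negative_vec_def)
  define h where "h = herm w z"
  have hz: "herm z w = cnj h" by (simp add: h_def herm_cnj)
  define v where "v = w - (h / N) *s z"
  have vz: "herm v z = 0"
    using Nneg by (simp add: v_def herm_diff_left herm_scale_left N h_def)
  have "herm v v = herm v w"
    by (subst (2) v_def) (simp add: herm_diff_right herm_scale_right vz)
  also have "\<dots> = herm w w - complex_of_real ((cmod h)\<^sup>2 / N)"
    by (simp add: v_def herm_diff_left herm_scale_left hz complex_norm_square[symmetric] del: of_real_power)
  finally have "Re (herm v v) = Re (herm w w) - (cmod h)\<^sup>2 / N" by (simp del: of_real_divide)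
  with herm_orthogonal_nonneg[OF assms(1) vz] have "(cmod h)\<^sup>2 / N \<le> Re (herm w w)" by simp
  hence "N * Re (herm w w) \<le> (cmod h)\<^sup>2" using Nneg by (simp add: field_simps)
  thus ?thesis by (simp add: N_def hz)
qed

text \<open>The description in \<open>rho\<close> determines a unique number, for any choice of representatives.\<close>

lemma rho_span:
  assumes z: "negative_vec z" and w: "negative_vec w"
  shows "0 \<le> rho (vec.span {z}) (vec.span {w})"
    and "complex_of_real ((cosh (rho (vec.span {z}) (vec.span {w}) / 2))\<^sup>2) =
           herm z w * herm w z / (herm z z * herm w w)"
proof -
  define q where "q z w = (cmod (herm z w))\<^sup>2 / (Re (herm z z) * Re (herm w w))" for z w
  have hq: "herm z w * herm w z / (herm z z * herm w w) = complex_of_real (q z w)" for z w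
  proof -
    have "herm y y = complex_of_real (Re (herm y y))" for y
      by (simp add: complex_eq_iff herm_self_real)
    moreover have "herm z w * herm w z = complex_of_real ((cmod (herm z w))\<^sup>2)"
      by (metis complex_norm_square herm_cnj)
    ultimately show ?thesis unfolding q_def
      by (metis of_real_divide of_real_mult)
  qed
  have q1: "q z w \<ge> 1"
    using reverse_Cauchy_Schwarz[OF z w] z w
    by (simp add: q_def negative_vec_def mult_neg_neg)
  have same: "q z' w' = q z w"
    if zw: "z' \<in> vec.span {z}" "w' \<in> vec.span {w}" "negative_vec z'" "negative_vec w'" for z' w'
  proof -
    obtain c d where c: "z' = c *s z" and d: "w' = d *s w"
      using zw(1,2) by (auto simp: vec.span_singleton)
    have "c \<noteq> 0" "d \<noteq> 0"
      using zw(3,4) by (auto simp: c d negative_vec_def herm_scale_left)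
    define k where "k = c * cnj c * d * cnj d"
    have "herm z' w' * herm w' z' = k * (herm z w * herm w z)"
      by (simp only: c d herm_scale_left herm_scale_right k_def mult_ac)
    moreover have "herm z' z' * herm w' w' = k * (herm z z * herm w w)"
      by (simp only: c d herm_scale_left herm_scale_right k_def mult_ac)
    moreover have "k \<noteq> 0" using \<open>c \<noteq> 0\<close> \<open>d \<noteq> 0\<close> by (simp add: k_def)
    ultimately have "complex_of_real (q z' w') = complex_of_real (q z w)"
      unfolding hq[symmetric] by (simp only: mult_divide_mult_cancel_left_if if_False)
    thus ?thesis by (simp only: of_real_eq_iff)
  qed
  define P where "P r \<longleftrightarrow> 0 \<le> r \<and>
     (\<forall>z'\<in>vec.span {z}. \<forall>w'\<in>vec.span {w}. negative_vec z' \<longrightarrow> negative_vec w' \<longrightarrow>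
        complex_of_real ((cosh (r / 2))\<^sup>2) =
          herm z' w' * herm w' z' / (herm z' z' * herm w' w'))" for r
  have P: "P r \<longleftrightarrow> 0 \<le> r \<and> (cosh (r / 2))\<^sup>2 = q z w" for r
  proof -
    have "z \<in> vec.span {z}" "w \<in> vec.span {w}" by (simp_all add: vec.span_base)
    with same z w show ?thesis unfolding P_def hq of_real_eq_iff by metis
  qed
  define r0 where "r0 = 2 * arcosh (sqrt (q z w))"
  have "P r0"
    unfolding P r0_def using q1 by (simp add: arcosh_nonneg_real cosh_arcosh_real)
  moreover have "r = r0" if r: "P r" for r
  proof -
    have c: "cosh (r / 2) = sqrt (q z w)"
      using r cosh_real_nonneg[of "r / 2"] unfolding P by (metis real_sqrt_unique)
    have "arcosh (cosh (r / 2)) = r / 2"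
      using r unfolding P by (intro arcosh_cosh_real) simp
    thus ?thesis unfolding r0_def c by simp
  qed
  moreover have "rho (vec.span {z}) (vec.span {w}) = (THE r. P r)"
    unfolding rho_def P_def ..
  ultimately have "P (rho (vec.span {z}) (vec.span {w}))"
    using theI[of P r0] by metis
  thus "0 \<le> rho (vec.span {z}) (vec.span {w})"
    and "complex_of_real ((cosh (rho (vec.span {z}) (vec.span {w}) / 2))\<^sup>2) =
           herm z w * herm w z / (herm z z * herm w w)"
    unfolding P hq by auto
qed


section \<open>The group PU(2,1)\<close>

definition U21 :: "(complex ^ 3 ^ 3) monoid" where
  "U21 = \<lparr>carrier = {A. \<forall>z w. herm (A *v z) (A *v w) = herm z w},
          mult = (**), one = mat 1\<rparr>"

definition scalars21 :: "(complex ^ 3 ^ 3) set" where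
  "scalars21 = carrier U21 \<inter> range mat"

text \<open>An element of \<open>PU21\<close> is a coset, that is, the set of all its representing matrices
  in \<open>U21\<close>.\<close>

definition PU21 :: "(complex ^ 3 ^ 3) set monoid" where
  "PU21 = U21 Mod scalars21"

text \<open>The quotient topology of the subspace topology that \<open>U21\<close> inherits from the space of
  matrices; see \<open>quotient_map_PU21\<close> below.\<close>

definition PU21_topology :: "(complex ^ 3 ^ 3) set topology" where
  "PU21_topology = topology (\<lambda>S. S \<subseteq> carrier PU21 \<and>
     openin (top_of_set (carrier U21)) {A \<in> carrier U21. scalars21 #>\<^bsub>U21\<^esub> A \<in> S})"

definition discrete_in_PU21 :: "(complex ^ 3 ^ 3) set set \<Rightarrow> bool" where
  "discrete_in_PU21 H \<longleftrightarrow> subtopology PU21_topology H = discrete_topology H"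

definition PU21_act :: "(complex ^ 3 ^ 3) set \<Rightarrow> point \<Rightarrow> point" where
  "PU21_act f x = {A *v v | A v. A \<in> f \<and> v \<in> x}"

lemma group_U21: "group U21"
proof (rule groupI)
  fix A assume "A \<in> carrier U21"
  hence A: "herm (A *v z) (A *v w) = herm z w" for z w by (simp add: U21_def)
  have "inj ((*v) A)"
  proof (rule injI)
    fix x y assume "A *v x = A *v y"
    hence "A *v (x - y) = 0" by (simp add: matrix_vector_mult_diff_distrib)
    hence "herm (x - y) w = 0" for w
      using A[of "x - y" w] by (simp add: herm_expand)
    hence "x - y = 0" by (rule herm_nondegenerate)
    thus "x = y" by simp
  qed
  then obtain B where B: "B ** A = mat 1" by (metis matrix_left_invertible_injective)
  hence AB: "A ** B = mat 1" by (metis matrix_left_right_inverse)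
  have "herm (B *v z) (B *v w) = herm z w" for z w
    using A[of "B *v z" "B *v w"] by (simp add: matrix_vector_mul_assoc AB)
  thus "\<exists>y\<in>carrier U21. y \<otimes>\<^bsub>U21\<^esub> A = \<one>\<^bsub>U21\<^esub>" using B by (auto simp: U21_def)
qed (auto simp: U21_def matrix_mul_assoc simp flip: matrix_vector_mul_assoc)

lemma mat_mult_commute: "mat c ** A = A ** mat (c :: complex)" for A :: "complex ^ 3 ^ 3"
  by (simp add: matrix_matrix_mult_def mat_def vec_eq_iff forall_3 sum_3 mult.commute)

lemma mat_mult_mat: "mat c ** mat d = (mat (c * d) :: complex ^ 3 ^ 3)"
  by (simp add: matrix_matrix_mult_def mat_def vec_eq_iff forall_3 sum_3)

lemma normal_scalars21: "scalars21 \<lhd> U21"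
proof -
  interpret U: group U21 by (rule group_U21)
  have "subgroup scalars21 U21"
  proof (rule U.subgroupI)
    show "scalars21 \<subseteq> carrier U21" by (auto simp: scalars21_def)
    have "\<one>\<^bsub>U21\<^esub> \<in> scalars21" using U.one_closed by (auto simp: scalars21_def) (simp add: U21_def)
    thus "scalars21 \<noteq> {}" by blast
  next
    fix A assume A: "A \<in> scalars21"
    then obtain c where c: "A = mat c" by (auto simp: scalars21_def)
    have Ac: "A \<in> carrier U21" using A by (simp add: scalars21_def)
    let ?B = "inv\<^bsub>U21\<^esub> A"
    have AB: "A ** ?B = mat 1" using U.r_inv[OF Ac] by (simp add: U21_def)
    hence "c \<noteq> 0"
      by (auto simp: c matrix_matrix_mult_def mat_def vec_eq_iff forall_3 sum_3)
    hence "mat (inverse c) ** A = mat 1" by (simp add: c mat_mult_mat)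
    hence "?B = mat (inverse c)"
      by (metis AB matrix_mul_assoc matrix_mul_lid matrix_mul_rid)
    thus "?B \<in> scalars21" using U.inv_closed[OF Ac] by (simp add: scalars21_def)
  next
    fix A B assume "A \<in> scalars21" "B \<in> scalars21"
    thus "A \<otimes>\<^bsub>U21\<^esub> B \<in> scalars21"
      using U.m_closed[of A B] by (auto simp: scalars21_def) (auto simp: U21_def mat_mult_mat)
  qed
  moreover have "A \<otimes>\<^bsub>U21\<^esub> H \<otimes>\<^bsub>U21\<^esub> inv\<^bsub>U21\<^esub> A \<in> scalars21"
    if "A \<in> carrier U21" "H \<in> scalars21" for A H
  proof -
    from that(2) have H: "H \<in> carrier U21" and "\<exists>c. H = mat c" by (auto simp: scalars21_def)
    hence "A \<otimes>\<^bsub>U21\<^esub> H = H \<otimes>\<^bsub>U21\<^esub> A" by (auto simp: U21_def mat_mult_commute)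
    thus ?thesis using that H by (simp add: U.m_assoc)
  qed
  ultimately show ?thesis by (simp add: U.normal_inv_iff)
qed

lemma group_PU21: "group PU21"
  unfolding PU21_def by (rule normal.factorgroup_is_group[OF normal_scalars21])

lemma openin_PU21_topology:
  "openin PU21_topology S \<longleftrightarrow> S \<subseteq> carrier PU21 \<and>
     openin (top_of_set (carrier U21)) {A \<in> carrier U21. scalars21 #>\<^bsub>U21\<^esub> A \<in> S}"
proof -
  let ?pre = "\<lambda>S. {A \<in> carrier U21. scalars21 #>\<^bsub>U21\<^esub> A \<in> S}"
  have "istopology (\<lambda>S. S \<subseteq> carrier PU21 \<and> openin (top_of_set (carrier U21)) (?pre S))"
    unfolding istopology_def
  proof (intro conjI allI impI)
    fix S T
    assume "S \<subseteq> carrier PU21 \<and> openin (top_of_set (carrier U21)) (?pre S)"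
      "T \<subseteq> carrier PU21 \<and> openin (top_of_set (carrier U21)) (?pre T)"
    moreover have "?pre (S \<inter> T) = ?pre S \<inter> ?pre T" by blast
    ultimately show "S \<inter> T \<subseteq> carrier PU21" "openin (top_of_set (carrier U21)) (?pre (S \<inter> T))"
      by (auto simp del: Int_iff)
  next
    fix \<K>
    assume *: "\<forall>K\<in>\<K>. K \<subseteq> carrier PU21 \<and> openin (top_of_set (carrier U21)) (?pre K)"
    have "?pre (\<Union>\<K>) = (\<Union>K\<in>\<K>. ?pre K)" by blast
    with * show "\<Union>\<K> \<subseteq> carrier PU21" "openin (top_of_set (carrier U21)) (?pre (\<Union>\<K>))"
      by auto
  qed
  thus ?thesis unfolding PU21_topology_def by (simp add: topology_inverse')
qed

lemma topspace_PU21_topology: "topspace PU21_topology = carrier PU21"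
proof -
  have "{A \<in> carrier U21. scalars21 #>\<^bsub>U21\<^esub> A \<in> carrier PU21} = carrier U21"
    by (auto simp: PU21_def carrier_FactGroup)
  hence "openin PU21_topology (carrier PU21)"
    by (simp add: openin_PU21_topology)
  hence "carrier PU21 \<subseteq> topspace PU21_topology" by (rule openin_subset)
  moreover have "topspace PU21_topology \<subseteq> carrier PU21"
    using openin_topspace[of PU21_topology] unfolding openin_PU21_topology by blast
  ultimately show ?thesis by (rule subset_antisym[rotated])
qed

lemma quotient_map_PU21:
  "quotient_map (top_of_set (carrier U21)) PU21_topology (\<lambda>A. scalars21 #>\<^bsub>U21\<^esub> A)"
  by (auto simp: quotient_map_def topspace_PU21_topology openin_PU21_topology
      PU21_def carrier_FactGroup)


section \<open>Elliptic elements and complex reflections\<close>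

definition elliptic :: "(complex ^ 3 ^ 3) set \<Rightarrow> bool" where
  "elliptic f \<longleftrightarrow> f \<in> carrier PU21 \<and> (\<exists>x\<in>HC2. PU21_act f x = x)"

definition eigenspace :: "complex ^ 3 ^ 3 \<Rightarrow> complex \<Rightarrow> (complex ^ 3) set" where
  "eigenspace A c = {v. A *v v = c *s v}"

text \<open>An eigenvalue with a two-dimensional eigenspace is automatically a repeated one.\<close>

definition reflection_in_line :: "(complex ^ 3 ^ 3) set \<Rightarrow> point set \<Rightarrow> bool" where
  "reflection_in_line f L \<longleftrightarrow> elliptic f \<and> f \<noteq> \<one>\<^bsub>PU21\<^esub> \<and> complex_line L \<and>
     (\<exists>A\<in>f. \<exists>c. vec.dim (eigenspace A c) = 2 \<and>
        (\<exists>v\<in>eigenspace A c. positive_vec v) \<and>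
        (\<exists>v\<in>eigenspace A c. negative_vec v) \<and>
        L = hyp_part (eigenspace A c))"

definition reflection_in_point :: "(complex ^ 3 ^ 3) set \<Rightarrow> point \<Rightarrow> bool" where
  "reflection_in_point f x \<longleftrightarrow> elliptic f \<and> f \<noteq> \<one>\<^bsub>PU21\<^esub> \<and>
     (\<exists>A\<in>f. \<exists>c d u. negative_vec u \<and> x = vec.span {u} \<and> eigenspace A c = vec.span {u} \<and>
        vec.dim (eigenspace A d) = 2 \<and>
        (\<exists>p q. positive_vec p \<and> positive_vec q \<and> eigenspace A d = vec.span {p, q}) \<and>
        eigenspace A d = {v. herm v u = 0})"


section \<open>Free products of groups\<close>

text \<open>The free product of \<open>G\<close> and \<open>H\<close> consists of the words in the disjoint union of the two
  carriers, multiplied by concatenation, modulo the congruence which multiplies adjacent letters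
  from the same factor and deletes identity letters.\<close>

definition fp_words :: "('a, 'c) monoid_scheme \<Rightarrow> ('b, 'd) monoid_scheme \<Rightarrow> ('a + 'b) list set"
  where "fp_words G H = lists (carrier G <+> carrier H)"

inductive fp_step ::
  "('a, 'c) monoid_scheme \<Rightarrow> ('b, 'd) monoid_scheme \<Rightarrow> ('a + 'b) list \<Rightarrow> ('a + 'b) list \<Rightarrow> bool"
  for G H where
  mult_left: "\<lbrakk>u \<in> fp_words G H; v \<in> fp_words G H; x \<in> carrier G; y \<in> carrier G\<rbrakk>
    \<Longrightarrow> fp_step G H (u @ [Inl x, Inl y] @ v) (u @ [Inl (x \<otimes>\<^bsub>G\<^esub> y)] @ v)"
| mult_right: "\<lbrakk>u \<in> fp_words G H; v \<in> fp_words G H; x \<in> carrier H; y \<in> carrier H\<rbrakk>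
    \<Longrightarrow> fp_step G H (u @ [Inr x, Inr y] @ v) (u @ [Inr (x \<otimes>\<^bsub>H\<^esub> y)] @ v)"
| one_left: "\<lbrakk>u \<in> fp_words G H; v \<in> fp_words G H\<rbrakk>
    \<Longrightarrow> fp_step G H (u @ [Inl \<one>\<^bsub>G\<^esub>] @ v) (u @ v)"
| one_right: "\<lbrakk>u \<in> fp_words G H; v \<in> fp_words G H\<rbrakk>
    \<Longrightarrow> fp_step G H (u @ [Inr \<one>\<^bsub>H\<^esub>] @ v) (u @ v)"

definition fp_rel :: "('a, 'c) monoid_scheme \<Rightarrow> ('b, 'd) monoid_scheme \<Rightarrow> ('a + 'b) list rel"
  where "fp_rel G H = {(u, v) \<in> fp_words G H \<times> fp_words G H. equivclp (fp_step G H) u v}"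

definition free_product ::
  "('a, 'c) monoid_scheme \<Rightarrow> ('b, 'd) monoid_scheme \<Rightarrow> ('a + 'b) list set monoid" where
  "free_product G H =
     \<lparr>carrier = fp_words G H // fp_rel G H,
      mult = (\<lambda>U V. \<Union>u\<in>U. \<Union>v\<in>V. fp_rel G H `` {u @ v}),
      one = fp_rel G H `` {[]}\<rparr>"

lemma equiv_fp_rel: "equiv (fp_words G H) (fp_rel G H)"
proof (rule equivI)
  show "refl_on (fp_words G H) (fp_rel G H)"
    by (auto simp: refl_on_def fp_rel_def)
  show "sym (fp_rel G H)"
    by (auto simp: sym_def fp_rel_def intro: equivclp_sym)
  show "trans (fp_rel G H)"
    by (auto simp: trans_def fp_rel_def intro: equivclp_trans)
qed (auto simp: fp_rel_def)

lemma fp_step_context: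
  assumes "fp_step G H u v" "a \<in> fp_words G H" "b \<in> fp_words G H"
  shows "fp_step G H (a @ u @ b) (a @ v @ b)"
  using assms(1)
proof cases
  case (mult_left s t x y)
  thus ?thesis using fp_step.mult_left[of "a @ s" G H "t @ b" x y] assms(2,3)
    by (simp add: fp_words_def)
next
  case (mult_right s t x y)
  thus ?thesis using fp_step.mult_right[of "a @ s" G H "t @ b" x y] assms(2,3)
    by (simp add: fp_words_def)
next
  case (one_left s t)
  thus ?thesis using fp_step.one_left[of "a @ s" G H "t @ b"] assms(2,3)
    by (simp add: fp_words_def)
next
  case (one_right s t)
  thus ?thesis using fp_step.one_right[of "a @ s" G H "t @ b"] assms(2,3)
    by (simp add: fp_words_def)
qed

lemma fp_equivclp_context:
  assumes "equivclp (fp_step G H) u v" "a \<in> fp_words G H" "b \<in> fp_words G H"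
  shows "equivclp (fp_step G H) (a @ u @ b) (a @ v @ b)"
  using assms(1)
proof (induction rule: equivclp_induct)
  case base show ?case by simp
next
  case (step y z)
  have "equivclp (fp_step G H) (a @ y @ b) (a @ z @ b)"
    using step(2) fp_step_context[OF _ assms(2,3)]
    by (meson equivclp_sym r_into_equivclp)
  with step show ?case by (meson equivclp_trans)
qed

lemma fp_append_closed: "u \<in> fp_words G H \<Longrightarrow> v \<in> fp_words G H \<Longrightarrow> u @ v \<in> fp_words G H"
  by (simp add: fp_words_def)

lemma fp_append_congruent:
  "congruent2 (fp_rel G H) (fp_rel G H) (\<lambda>u v. fp_rel G H `` {u @ v})"
proof (rule congruent2I')
  fix u u' v v' assume *: "(u, u') \<in> fp_rel G H" "(v, v') \<in> fp_rel G H"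
  have nil: "[] \<in> fp_words G H" by (simp add: fp_words_def)
  have "equivclp (fp_step G H) (u @ v) (u' @ v)"
    using fp_equivclp_context[of G H u u' "[]" v] * nil by (auto simp: fp_rel_def)
  moreover have "equivclp (fp_step G H) (u' @ v) (u' @ v')"
    using fp_equivclp_context[of G H v v' u' "[]"] * nil by (auto simp: fp_rel_def)
  ultimately have "(u @ v, u' @ v') \<in> fp_rel G H"
    using * by (auto simp: fp_rel_def fp_append_closed intro: equivclp_trans)
  thus "fp_rel G H `` {u @ v} = fp_rel G H `` {u' @ v'}"
    by (rule equiv_class_eq[OF equiv_fp_rel])
qed

lemma free_product_mult_class:
  assumes "u \<in> fp_words G H" "v \<in> fp_words G H"
  shows "fp_rel G H `` {u} \<otimes>\<^bsub>free_product G H\<^esub> fp_rel G H `` {v} = fp_rel G H `` {u @ v}"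
  using UN_equiv_class2[OF equiv_fp_rel equiv_fp_rel fp_append_congruent assms]
  by (simp add: free_product_def)

lemma group_free_product:
  assumes "group G" "group H"
  shows "group (free_product G H)"
proof -
  interpret G: group G by fact
  interpret H: group H by fact
  let ?R = "fp_rel G H" and ?W = "fp_words G H" and ?P = "free_product G H"
  have nil: "[] \<in> ?W" by (simp add: fp_words_def)
  have carr: "x \<in> carrier ?P \<longleftrightarrow> (\<exists>u\<in>?W. x = ?R `` {u})" for x
    by (auto simp: free_product_def quotient_def)
  have one: "\<one>\<^bsub>?P\<^esub> = ?R `` {[]}" by (simp add: free_product_def)
  have linv: "\<exists>v\<in>?W. equivclp (fp_step G H) (v @ u) []" if "u \<in> ?W" for u
    using that
  proof (induction u)
    case Nil show ?case using nil by (intro bexI[of _ "[]"]) simp_all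
  next
    case (Cons a u)
    hence u: "u \<in> ?W" and a: "a \<in> carrier G <+> carrier H" by (auto simp: fp_words_def)
    from Cons.IH[OF u] obtain v where v: "v \<in> ?W" "equivclp (fp_step G H) (v @ u) []" by blast
    have "\<exists>b. [b] \<in> ?W \<and> equivclp (fp_step G H) (v @ [b, a] @ u) (v @ u)"
    proof (cases a)
      case (Inl x)
      hence x: "x \<in> carrier G" using a by auto
      have "fp_step G H (v @ [Inl (inv\<^bsub>G\<^esub> x), Inl x] @ u) (v @ [Inl \<one>\<^bsub>G\<^esub>] @ u)"
        using fp_step.mult_left[of v G H u "inv\<^bsub>G\<^esub> x" x] v(1) u x by simp
      hence "equivclp (fp_step G H) (v @ [Inl (inv\<^bsub>G\<^esub> x), Inl x] @ u) (v @ u)"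
        using fp_step.one_left[of v G H u] v(1) u
        by (meson equivclp_trans r_into_equivclp)
      thus ?thesis using x Inl by (intro exI[of _ "Inl (inv\<^bsub>G\<^esub> x)"]) (auto simp: fp_words_def)
    next
      case (Inr x)
      hence x: "x \<in> carrier H" using a by auto
      have "fp_step G H (v @ [Inr (inv\<^bsub>H\<^esub> x), Inr x] @ u) (v @ [Inr \<one>\<^bsub>H\<^esub>] @ u)"
        using fp_step.mult_right[of v G H u "inv\<^bsub>H\<^esub> x" x] v(1) u x by simp
      hence "equivclp (fp_step G H) (v @ [Inr (inv\<^bsub>H\<^esub> x), Inr x] @ u) (v @ u)"
        using fp_step.one_right[of v G H u] v(1) u
        by (meson equivclp_trans r_into_equivclp)
      thus ?thesis using x Inr by (intro exI[of _ "Inr (inv\<^bsub>H\<^esub> x)"]) (auto simp: fp_words_def)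
    qed
    then obtain b where "[b] \<in> ?W" "equivclp (fp_step G H) (v @ [b, a] @ u) (v @ u)" by blast
    with v show ?case
      by (intro bexI[of _ "v @ [b]"]) (auto simp: fp_append_closed intro: equivclp_trans)
  qed
  show ?thesis
  proof (rule groupI)
    fix x y assume "x \<in> carrier ?P" "y \<in> carrier ?P"
    thus "x \<otimes>\<^bsub>?P\<^esub> y \<in> carrier ?P"
      unfolding carr by (metis free_product_mult_class fp_append_closed)
  next
    show "\<one>\<^bsub>?P\<^esub> \<in> carrier ?P" using nil by (auto simp: carr one)
  next
    fix x y z assume "x \<in> carrier ?P" "y \<in> carrier ?P" "z \<in> carrier ?P"
    thus "x \<otimes>\<^bsub>?P\<^esub> y \<otimes>\<^bsub>?P\<^esub> z = x \<otimes>\<^bsub>?P\<^esub> (y \<otimes>\<^bsub>?P\<^esub> z)"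
      by (auto simp: carr free_product_mult_class fp_append_closed)
  next
    fix x assume "x \<in> carrier ?P"
    thus "\<one>\<^bsub>?P\<^esub> \<otimes>\<^bsub>?P\<^esub> x = x"
      using nil by (auto simp: carr one free_product_mult_class)
  next
    fix x assume "x \<in> carrier ?P"
    then obtain u where u: "u \<in> ?W" "x = ?R `` {u}" by (auto simp: carr)
    with linv obtain v where v: "v \<in> ?W" "equivclp (fp_step G H) (v @ u) []" by blast
    hence "(v @ u, []) \<in> ?R" using u nil by (simp add: fp_rel_def fp_append_closed)
    hence "?R `` {v} \<otimes>\<^bsub>?P\<^esub> x = \<one>\<^bsub>?P\<^esub>"
      using u v equiv_class_eq[OF equiv_fp_rel] by (simp add: free_product_mult_class one)
    moreover have "?R `` {v} \<in> carrier ?P" using v by (auto simp: carr)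
    ultimately show "\<exists>y\<in>carrier ?P. y \<otimes>\<^bsub>?P\<^esub> x = \<one>\<^bsub>?P\<^esub>" by blast
  qed
qed

end

(* In homogeneous coordinates f and g are z |-> z + (zeta - 1) <z,p>/<p,p> p and
   z |-> z + (omega - 1) <z,q>/<q,q> q, where p and q are polar to the fixed lines or represent the
   fixed points; both are normalised to <p,p>, <q,q> = +1 or -1. On the complex line determined by
   p and q they act as rotations, and the angular coordinate of z about the fixed point of f is the
   argument of
     V(z) = <p,q> <z,p> cnj (<z,p> <p,q> - <p,p> <z,q>),
   which f multiplies by zeta. Hence all nontrivial powers of f move the open sector
   |arg V| < pi/m off itself, and likewise for g. Writing W = <z,p> cnj <z,q> <p,q> = x + iy and
   K = |<p,q>|^2, a vector outside both sectors satisfies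
     K (x^2 + y^2) <= (s1 x + cot(pi/m) |y|) (s2 x + cot(pi/n) |y|)  with s1 = <p,p>, s2 = <q,q>,
   and the difference of the two sides is definite exactly if
     2 K - s1 s2 > cot(pi/m) cot(pi/n) + 1 / (sin(pi/m) sin(pi/n)).
   As cosh delta is at most max 1 (2 K - s1 s2), the hypothesis makes the complements of the
   sectors disjoint, so ping-pong applies: nontrivial elements of the group move the open
   intersection of the two sectors off itself, which gives both freeness and discreteness. *)

theory Submission
  imports Defs
begin

section \<open>Words in a free product\<close>

text \<open>Both summands carry the type of one group because the factors will be subgroups of it.
  On classes of words this becomes the canonical homomorphism from their free product.\<close>

definition fp_eval :: "('a, 'c) monoid_scheme \<Rightarrow> ('a + 'a) list \<Rightarrow> 'a" where
  "fp_eval G w = foldr (\<lambda>x y. case_sum id id x \<otimes>\<^bsub>G\<^esub> y) w \<one>\<^bsub>G\<^esub>"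

lemma fp_eval_simps [simp]:
  "fp_eval G [] = \<one>\<^bsub>G\<^esub>"
  "fp_eval G (Inl x # w) = x \<otimes>\<^bsub>G\<^esub> fp_eval G w"
  "fp_eval G (Inr x # w) = x \<otimes>\<^bsub>G\<^esub> fp_eval G w"
  by (simp_all add: fp_eval_def)

text \<open>The usual normal form: letters alternate between the factors and none is an
  identity.\<close>

fun fp_reduced :: "('a, 'c) monoid_scheme \<Rightarrow> ('b, 'd) monoid_scheme \<Rightarrow> ('a + 'b) list \<Rightarrow> bool" where
  "fp_reduced G H [] \<longleftrightarrow> True"
| "fp_reduced G H (x # w) \<longleftrightarrow> x \<notin> {Inl \<one>\<^bsub>G\<^esub>, Inr \<one>\<^bsub>H\<^esub>} \<and> fp_reduced G H w \<and>
     (w = [] \<or> isl x \<noteq> isl (hd w))"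

lemma fp_words_simps [simp]:
  "[] \<in> fp_words G H"
  "Inl x # w \<in> fp_words G H \<longleftrightarrow> x \<in> carrier G \<and> w \<in> fp_words G H"
  "Inr y # w \<in> fp_words G H \<longleftrightarrow> y \<in> carrier H \<and> w \<in> fp_words G H"
  "u @ v \<in> fp_words G H \<longleftrightarrow> u \<in> fp_words G H \<and> v \<in> fp_words G H"
  by (auto simp: fp_words_def)

text \<open>Only the junction of \<open>x\<close> and \<open>r\<close> can violate reducedness. If
  both letters come from one factor they are merged: a trivial product leaves the reduced tail
  \<open>s\<close>, and any other product is a letter of the same factor as the old head, so
  alternation survives.\<close>

lemma fp_reduce_Cons:
  assumes "group G" "group H" "[x] \<in> fp_words G H" "r \<in> fp_words G H" "fp_reduced G H r"
  shows "\<exists>r'\<in>fp_words G H. fp_reduced G H r' \<and> equivclp (fp_step G H) (x # r) r'"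
proof -
  interpret G: group G by fact
  interpret H: group H by fact
  consider (l1) "x = Inl \<one>\<^bsub>G\<^esub>" | (r1) "x = Inr \<one>\<^bsub>H\<^esub>"
    | (irr) "x \<notin> {Inl \<one>\<^bsub>G\<^esub>, Inr \<one>\<^bsub>H\<^esub>}" "r = [] \<or> isl x \<noteq> isl (hd r)"
    | (l2) a b s where "x = Inl a" "r = Inl b # s"
    | (r2) a b s where "x = Inr a" "r = Inr b # s"
    by (cases x; cases r; cases "hd r") auto
  thus ?thesis
  proof cases
    case l1
    with fp_step.one_left[of "[]" G H r] assms show ?thesis by (auto intro!: bexI[of _ r])
  next
    case r1
    with fp_step.one_right[of "[]" G H r] assms show ?thesis by (auto intro!: bexI[of _ r])
  next
    case irr
    hence "x # r \<in> fp_words G H" "fp_reduced G H (x # r)"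
      using assms by (cases x; auto)+
    thus ?thesis by (meson equivclp_refl)
  next
    case (l2 a b s)
    have 1: "equivclp (fp_step G H) (x # r) (Inl (a \<otimes>\<^bsub>G\<^esub> b) # s)"
      using fp_step.mult_left[of "[]" G H s a b] assms(3,4) l2 by auto
    show ?thesis
    proof (cases "a \<otimes>\<^bsub>G\<^esub> b = \<one>\<^bsub>G\<^esub>")
      case True
      have "equivclp (fp_step G H) (Inl (a \<otimes>\<^bsub>G\<^esub> b) # s) s"
        using fp_step.one_left[of "[]" G H s] assms(4) l2 True by auto
      with 1 show ?thesis using assms(4,5) l2 by (auto intro!: bexI[of _ s] intro: equivclp_trans)
    next
      case False
      with 1 show ?thesis using assms(3-5) l2
        by (intro bexI[of _ "Inl (a \<otimes>\<^bsub>G\<^esub> b) # s"]) auto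
    qed
  next
    case (r2 a b s)
    have 1: "equivclp (fp_step G H) (x # r) (Inr (a \<otimes>\<^bsub>H\<^esub> b) # s)"
      using fp_step.mult_right[of "[]" G H s a b] assms(3,4) r2 by auto
    show ?thesis
    proof (cases "a \<otimes>\<^bsub>H\<^esub> b = \<one>\<^bsub>H\<^esub>")
      case True
      have "equivclp (fp_step G H) (Inr (a \<otimes>\<^bsub>H\<^esub> b) # s) s"
        using fp_step.one_right[of "[]" G H s] assms(4) r2 True by auto
      with 1 show ?thesis using assms(4,5) r2 by (auto intro!: bexI[of _ s] intro: equivclp_trans)
    next
      case False
      with 1 show ?thesis using assms(3-5) r2
        by (intro bexI[of _ "Inr (a \<otimes>\<^bsub>H\<^esub> b) # s"]) auto
    qed
  qed
qed

lemma fp_reduced_representative: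
  assumes "group G" "group H" "w \<in> fp_words G H"
  shows "\<exists>r\<in>fp_words G H. fp_reduced G H r \<and> equivclp (fp_step G H) w r"
  using assms(3)
proof (induction w)
  case Nil
  show ?case by (intro bexI[of _ "[]"]) auto
next
  case (Cons x w)
  hence x: "[x] \<in> fp_words G H" and w: "w \<in> fp_words G H" by (cases x; simp)+
  from Cons.IH[OF w] obtain r where
    r: "r \<in> fp_words G H" "fp_reduced G H r" "equivclp (fp_step G H) w r" by blast
  have "equivclp (fp_step G H) (x # w) (x # r)"
    using fp_equivclp_context[OF r(3) x, of "[]"] by simp
  with fp_reduce_Cons[OF assms(1,2) x r(1,2)] show ?case by (meson equivclp_trans)
qed

section \<open>Evaluation of words over two subgroups of a group\<close>

context
  fixes G :: "('a, 'c) monoid_scheme" (structure) and A B :: "'a set"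
  assumes G: "group G" and A: "subgroup A G" and B: "subgroup B G"
begin

interpretation group G by (rule G)
interpretation A: subgroup A G by (rule A)
interpretation B: subgroup B G by (rule B)

abbreviation (input) "GA \<equiv> G\<lparr>carrier := A\<rparr>"
abbreviation (input) "GB \<equiv> G\<lparr>carrier := B\<rparr>"

lemma fp_eval_closed: "w \<in> fp_words GA GB \<Longrightarrow> fp_eval G w \<in> generate G (A \<union> B)"
proof (induction w)
  case Nil
  show ?case by (simp add: generate.one)
next
  case (Cons x w)
  thus ?case by (cases x) (auto intro!: generate.eng intro: generate.incl)
qed

lemma fp_eval_in_carrier: "w \<in> fp_words GA GB \<Longrightarrow> fp_eval G w \<in> carrier G"
  by (rule subsetD[OF generate_incl fp_eval_closed]) auto

lemma fp_eval_append:
  "u \<in> fp_words GA GB \<Longrightarrow> v \<in> fp_words GA GB \<Longrightarrow>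
    fp_eval G (u @ v) = fp_eval G u \<otimes> fp_eval G v"
proof (induction u)
  case Nil
  thus ?case by (simp add: fp_eval_in_carrier)
next
  case (Cons x u)
  thus ?case by (cases x) (auto simp: m_assoc fp_eval_in_carrier)
qed

lemma fp_eval_step: "fp_step GA GB u v \<Longrightarrow> fp_eval G u = fp_eval G v"
  by (induction rule: fp_step.induct)
     (auto simp: fp_eval_append fp_eval_in_carrier m_assoc simp flip: append_Cons)

lemma fp_eval_equivclp: "equivclp (fp_step GA GB) u v \<Longrightarrow> fp_eval G u = fp_eval G v"
  by (induction rule: equivclp_induct) (auto dest: fp_eval_step)

lemma generate_Un_fp_eval:
  "x \<in> generate G (A \<union> B) \<Longrightarrow> \<exists>w\<in>fp_words GA GB. x = fp_eval G w"
proof (induction rule: generate.induct)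
  case one
  show ?case by (intro bexI[of _ "[]"]) auto
next
  case (incl h)
  hence "h \<in> A \<or> h \<in> B" by blast
  thus ?case
    by (auto intro: bexI[of _ "[Inl h]"] bexI[of _ "[Inr h]"])
next
  case (inv h)
  hence "inv h \<in> A \<or> inv h \<in> B" by blast
  thus ?case
    by (auto intro: bexI[of _ "[Inl (inv h)]"] bexI[of _ "[Inr (inv h)]"])
next
  case (eng h1 h2)
  then obtain u v where "u \<in> fp_words GA GB" "h1 = fp_eval G u"
    "v \<in> fp_words GA GB" "h2 = fp_eval G v" by blast
  thus ?case by (intro bexI[of _ "u @ v"]) (auto simp: fp_eval_append)
qed

lemma generate_Un_fp_eval_reduced:
  assumes "x \<in> generate G (A \<union> B)"
  obtains w where "w \<in> fp_words GA GB" "fp_reduced GA GB w" "x = fp_eval G w"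
proof -
  from generate_Un_fp_eval[OF assms] obtain u where u: "u \<in> fp_words GA GB" "x = fp_eval G u"
    by blast
  from fp_reduced_representative[OF A.subgroup_is_group[OF G] B.subgroup_is_group[OF G] u(1)]
  obtain r where "r \<in> fp_words GA GB" "fp_reduced GA GB r" "equivclp (fp_step GA GB) u r"
    by blast
  with u that[of r] fp_eval_equivclp show thesis by metis
qed

text \<open>Evaluation is a homomorphism onto the generated subgroup. An element of its kernel has a
  reduced representative that evaluates to the identity, and the assumption forces that word to be
  empty.\<close>

lemma free_product_iso:
  assumes "\<And>w. w \<in> fp_words GA GB \<Longrightarrow> fp_reduced GA GB w \<Longrightarrow> w \<noteq> [] \<Longrightarrow> fp_eval G w \<noteq> \<one>"
  shows "G\<lparr>carrier := generate G (A \<union> B)\<rparr> \<cong> free_product GA GB"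
proof -
  let ?R = "fp_rel GA GB" and ?P = "free_product GA GB" and ?S = "G\<lparr>carrier := generate G (A \<union> B)\<rparr>"
  have P: "group ?P"
    by (intro group_free_product A.subgroup_is_group[OF G] B.subgroup_is_group[OF G])
  have S: "group ?S"
    by (intro subgroup.subgroup_is_group[OF _ G] generate_is_subgroup) auto
  \<comment> \<open>Evaluation at a chosen representative; by \<open>fp_eval_equivclp\<close> the
    value does not depend on the choice.\<close>
  define \<phi> where "\<phi> U = fp_eval G (SOME u. u \<in> U)" for U
  have \<phi>: "\<phi> (?R `` {u}) = fp_eval G u" if "u \<in> fp_words GA GB" for u
  proof -
    have "u \<in> ?R `` {u}" using that by (simp add: fp_rel_def)
    hence "(SOME v. v \<in> ?R `` {u}) \<in> ?R `` {u}" by (rule someI)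
    thus ?thesis unfolding \<phi>_def by (auto simp: fp_rel_def dest: fp_eval_equivclp)
  qed
  have carr: "x \<in> carrier ?P \<longleftrightarrow> (\<exists>u\<in>fp_words GA GB. x = ?R `` {u})" for x
    by (auto simp: free_product_def quotient_def)
  have hom: "\<phi> \<in> hom ?P ?S"
  proof (rule homI)
    fix x assume "x \<in> carrier ?P"
    thus "\<phi> x \<in> carrier ?S" by (auto simp: carr \<phi> fp_eval_closed)
  next
    fix x y assume "x \<in> carrier ?P" "y \<in> carrier ?P"
    thus "\<phi> (x \<otimes>\<^bsub>?P\<^esub> y) = \<phi> x \<otimes>\<^bsub>?S\<^esub> \<phi> y"
      by (auto simp: carr \<phi> free_product_mult_class fp_eval_append)
  qed
  interpret \<phi>: group_hom ?P ?S \<phi>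
    using P S hom by (simp add: group_hom_def group_hom_axioms_def)
  have "\<phi> \<in> iso ?P ?S"
    unfolding \<phi>.iso_iff
  proof (intro conjI subsetI ballI impI)
    fix x assume "x \<in> carrier ?S"
    with generate_Un_fp_eval obtain u where "u \<in> fp_words GA GB" "x = fp_eval G u" by auto
    thus "x \<in> \<phi> ` carrier ?P" using \<phi> carr by (metis image_eqI)
  next
    fix x assume x: "x \<in> carrier ?P" "\<phi> x = \<one>\<^bsub>?S\<^esub>"
    then obtain u where u: "u \<in> fp_words GA GB" "x = ?R `` {u}" by (auto simp: carr)
    from fp_reduced_representative[OF A.subgroup_is_group[OF G] B.subgroup_is_group[OF G] u(1)]
    obtain r where r: "r \<in> fp_words GA GB" "fp_reduced GA GB r" "equivclp (fp_step GA GB) u r"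
      by blast
    have "fp_eval G r = \<one>" using x(2) \<phi>[OF u(1)] fp_eval_equivclp[OF r(3)] u(2) by simp
    with assms r have "r = []" by blast
    with r u have "(u, []) \<in> ?R" by (simp add: fp_rel_def)
    thus "x = \<one>\<^bsub>?P\<^esub>"
      using u(2) equiv_class_eq[OF equiv_fp_rel] by (simp add: free_product_def)
  qed
  thus ?thesis using group.iso_sym[OF P] is_isoI by blast
qed

text \<open>The relation \<open>moves g S T\<close> stands for "\<open>g\<close> sends
  \<open>S\<close> into \<open>T\<close>"; keeping it abstract lets the group elements be cosets of
  matrices. The rightmost letter acts first, on \<open>D\<^sub>A \<inter> D\<^sub>B\<close>; every
  letter lands in the target of its own factor, which lies in the domain of the next letter, so the
  head of the word decides the final target.\<close>

lemma ping_pong_reduced: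
  fixes moves :: "'a \<Rightarrow> 's set \<Rightarrow> 's set \<Rightarrow> bool"
  assumes comp: "\<And>g h S T U. moves g T U \<Longrightarrow> moves h S T \<Longrightarrow> moves (g \<otimes> h) S U"
    and anti: "\<And>g S T U. moves g T U \<Longrightarrow> S \<subseteq> T \<Longrightarrow> moves g S U"
    and mA: "\<And>a. a \<in> A \<Longrightarrow> a \<noteq> \<one> \<Longrightarrow> moves a D\<^sub>A X\<^sub>A"
    and mB: "\<And>b. b \<in> B \<Longrightarrow> b \<noteq> \<one> \<Longrightarrow> moves b D\<^sub>B X\<^sub>B"
    and sub: "X\<^sub>B \<subseteq> D\<^sub>A" "X\<^sub>A \<subseteq> D\<^sub>B"
    and w: "w \<in> fp_words GA GB" "fp_reduced GA GB w" "w \<noteq> []"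
  shows "moves (fp_eval G w) (D\<^sub>A \<inter> D\<^sub>B) (if isl (hd w) then X\<^sub>A else X\<^sub>B)"
  using w
proof (induction w)
  case (Cons x w)
  have w: "w \<in> fp_words GA GB" "fp_reduced GA GB w" and x: "[x] \<in> fp_words GA GB"
    and alt: "w = [] \<or> isl x \<noteq> isl (hd w)"
    using Cons.prems by (cases x; simp)+
  show ?case
  proof (cases x)
    case (Inl a)
    hence a: "moves a D\<^sub>A X\<^sub>A" "a \<in> carrier G" using mA Cons.prems x by auto
    show ?thesis
    proof (cases "w = []")
      case True
      thus ?thesis using a anti[OF a(1)] Inl by simp
    next
      case False
      hence "moves (fp_eval G w) (D\<^sub>A \<inter> D\<^sub>B) X\<^sub>B" using Cons.IH w alt Inl by auto
      thus ?thesis using comp[OF anti[OF a(1) sub(1)]] Inl by simp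
    qed
  next
    case (Inr b)
    hence b: "moves b D\<^sub>B X\<^sub>B" "b \<in> carrier G" using mB Cons.prems x by auto
    show ?thesis
    proof (cases "w = []")
      case True
      thus ?thesis using b anti[OF b(1)] Inr by simp
    next
      case False
      hence "moves (fp_eval G w) (D\<^sub>A \<inter> D\<^sub>B) X\<^sub>A" using Cons.IH w alt Inr by auto
      thus ?thesis using comp[OF anti[OF b(1) sub(2)]] Inr by simp
    qed
  qed
qed simp

end

section \<open>Plane sectors and a definite quadratic form\<close>

text \<open>The cotangent condition describes the open sector \<open>|arg U| < pi/m\<close>. Its
  opening \<open>2 pi/m\<close> is the least angle through which a nontrivial \<open>m\<close>-th
  root of unity rotates. If \<open>U\<close> and \<open>\<zeta> * U\<close> were both in the sector,
  their inner product would give \<open>Re \<zeta> > cos (2 pi/m)\<close>, which no such root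
  satisfies.\<close>

lemma sector_rotated_off:
  fixes U \<zeta> :: complex
  assumes m: "m \<ge> 2" and \<zeta>: "\<zeta> ^ m = 1" "\<zeta> \<noteq> 1"
    and U: "Re U > cot (pi / real m) * \<bar>Im U\<bar>"
  shows "\<not> Re (\<zeta> * U) > cot (pi / real m) * \<bar>Im (\<zeta> * U)\<bar>"
proof
  assume V: "Re (\<zeta> * U) > cot (pi / real m) * \<bar>Im (\<zeta> * U)\<bar>"
  define \<alpha> where "\<alpha> = pi / real m"
  define R where "R = cmod U"
  have \<alpha>: "0 < \<alpha>" "\<alpha> \<le> pi / 2" using m by (auto simp: \<alpha>_def field_simps)
  hence s: "sin \<alpha> > 0" and c: "cos \<alpha> \<ge> 0"
    by (auto intro!: sin_gt_zero cos_ge_zero)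
  \<comment> \<open>If \<open>t\<close> is the argument of \<open>W\<close>, this says
    \<open>cos t > cos \<alpha>\<close> and \<open>|sin t| < sin \<alpha>\<close>, scaled by
    \<open>cmod W\<close>; squaring avoids arguments altogether.\<close>
  have bounds: "Re W > cos \<alpha> * cmod W \<and> \<bar>Im W\<bar> < sin \<alpha> * cmod W"
    if "Re W > cot \<alpha> * \<bar>Im W\<bar>" for W
  proof -
    have W: "Re W * sin \<alpha> > cos \<alpha> * \<bar>Im W\<bar>"
      using that s by (simp add: cot_def field_simps)
    have pos: "Re W > 0"
      using order.strict_trans1[OF _ W, of 0] c s zero_less_mult_pos2[of "Re W" "sin \<alpha>"] by simp
    have "(cos \<alpha> * \<bar>Im W\<bar>)\<^sup>2 < (Re W * sin \<alpha>)\<^sup>2"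
      using W c by (intro power_strict_mono) auto
    hence "(cos \<alpha>)\<^sup>2 * (Im W)\<^sup>2 < (sin \<alpha>)\<^sup>2 * (Re W)\<^sup>2" by (simp add: power_mult_distrib mult.commute)
    moreover have "t = (sin \<alpha>)\<^sup>2 * t + (cos \<alpha>)\<^sup>2 * t" for t
      by (simp flip: distrib_right)
    from this[of "(Re W)\<^sup>2"] this[of "(Im W)\<^sup>2"]
    have "(Re W)\<^sup>2 = (sin \<alpha>)\<^sup>2 * (Re W)\<^sup>2 + (cos \<alpha>)\<^sup>2 * (Re W)\<^sup>2"
      "(Im W)\<^sup>2 = (sin \<alpha>)\<^sup>2 * (Im W)\<^sup>2 + (cos \<alpha>)\<^sup>2 * (Im W)\<^sup>2" .
    ultimately have "(cos \<alpha> * cmod W)\<^sup>2 < (Re W)\<^sup>2" "\<bar>Im W\<bar>\<^sup>2 < (sin \<alpha> * cmod W)\<^sup>2"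
      unfolding power_mult_distrib cmod_power2 distrib_left power2_abs by linarith+
    thus ?thesis using pos s by (auto intro!: power2_less_imp_less[of "cos \<alpha> * cmod W"]
        power2_less_imp_less[of "\<bar>Im W\<bar>"])
  qed
  have [simp]: "cmod \<zeta> = 1"
    using \<zeta>(1) m power_eq_imp_eq_base[of "cmod \<zeta>" m 1] by (simp flip: norm_power)
  have b1: "Re U > cos \<alpha> * R" "\<bar>Im U\<bar> < sin \<alpha> * R"
    and b2: "Re (\<zeta> * U) > cos \<alpha> * R" "\<bar>Im (\<zeta> * U)\<bar> < sin \<alpha> * R"
    using bounds[of U] bounds[of "\<zeta> * U"] U V by (simp_all add: \<alpha>_def R_def norm_mult)
  have "Re U * Re (\<zeta> * U) > (cos \<alpha> * R) * (cos \<alpha> * R)"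
    using b1(1) b2(1) c by (intro mult_strict_mono') (auto simp: R_def)
  moreover have "\<bar>Im U * Im (\<zeta> * U)\<bar> \<le> (sin \<alpha> * R) * (sin \<alpha> * R)"
    unfolding abs_mult using b1(2) b2(2) by (intro mult_mono) auto
  moreover have "cos (2 * \<alpha>) * R\<^sup>2 = (cos \<alpha> * R) * (cos \<alpha> * R) - (sin \<alpha> * R) * (sin \<alpha> * R)"
    unfolding cos_double power2_eq_square by (simp add: algebra_simps)
  ultimately have "Re U * Re (\<zeta> * U) + Im U * Im (\<zeta> * U) > cos (2 * \<alpha>) * R\<^sup>2"
    by linarith
  \<comment> \<open>The real inner product of \<open>U\<close> with its rotated copy sees only the
    cosine of the rotation angle.\<close>
  moreover have "Re U * Re (\<zeta> * U) + Im U * Im (\<zeta> * U) = Re \<zeta> * R\<^sup>2"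
    by (simp add: R_def cmod_power2) (simp add: power2_eq_square algebra_simps)
  ultimately have gt: "Re \<zeta> > cos (2 * \<alpha>)"
    using mult_right_mono[of "Re \<zeta>" "cos (2 * \<alpha>)" "R\<^sup>2"] by force
  have "\<zeta> \<in> (\<lambda>k. cis (2 * pi * real k / real m)) ` {..<m}"
    using Complex.bij_betw_roots_unity[of m] \<zeta>(1) m by (auto simp: bij_betw_def)
  then obtain k where k: "k < m" "\<zeta> = cis (2 * pi * real k / real m)" by auto
  have "k \<noteq> 0" using \<zeta>(2) k by (intro notI) simp
  have k\<alpha>: "2 * pi * real k / real m = 2 * \<alpha> * k" by (simp add: \<alpha>_def)
  have tot: "2 * pi = 2 * \<alpha> * m" using m by (simp add: \<alpha>_def)
  \<comment> \<open>Here \<open>1 \<le> k < m\<close>. Angles beyond \<open>pi\<close> are reflected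
    to \<open>2 pi - 2 \<alpha> k\<close>, which is still at least \<open>2 \<alpha>\<close>, so
    that monotonicity of the cosine on \<open>[0, pi]\<close> applies.\<close>
  have "cos (2 * \<alpha> * k) \<le> cos (2 * \<alpha>)"
  proof (cases "2 * \<alpha> * k \<le> pi")
    case True
    thus ?thesis using \<alpha> \<open>k \<noteq> 0\<close> by (intro cos_monotone_0_pi_le) auto
  next
    case False
    have "cos (2 * \<alpha> * k) = cos (2 * pi - 2 * \<alpha> * k)" by (simp add: cos_diff)
    also have "2 * pi - 2 * \<alpha> * k = 2 * \<alpha> * (real m - k)" by (simp add: tot right_diff_distrib)
    also have "cos \<dots> \<le> cos (2 * \<alpha>)"
    proof (intro cos_monotone_0_pi_le)
      have "1 \<le> real m - k" using k by linarith
      thus "2 * \<alpha> \<le> 2 * \<alpha> * (real m - k)" using \<alpha> by simp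
      show "2 * \<alpha> * (real m - k) \<le> pi" using False tot by (simp add: right_diff_distrib)
    qed (use \<alpha> in auto)
    finally show ?thesis .
  qed
  with gt k k\<alpha> show False by simp
qed

text \<open>The inequality on \<open>C\<close> says exactly that the difference of the two sides of the last
  hypothesis has a positive definite matrix.\<close>

lemma quadratic_form_anisotropic:
  fixes K x y c1 c2 s1 s2 C :: real
  assumes s: "s1\<^sup>2 = 1" "s2\<^sup>2 = 1" and c: "c1 \<ge> 0" "c2 \<ge> 0"
    and C: "C = 2 * K - s1 * s2" "C > c1 * c2" "(C - c1 * c2)\<^sup>2 > (1 + c1\<^sup>2) * (1 + c2\<^sup>2)"
    and le: "K * (x\<^sup>2 + y\<^sup>2) \<le> (s1 * x + c1 * y) * (s2 * x + c2 * y)"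
  shows "x = 0 \<and> y = 0"
proof -
  define s e where "s = s1 * s2" and "e = s1 * c2 + s2 * c1"
  \<comment> \<open>Four times the determinant of the form
    \<open>(K - s) x^2 - e x y + (K - c1 c2) y^2\<close>.\<close>
  define d where "d = 4 * (K - s) * (K - c1 * c2) - e\<^sup>2"
  have ss: "s\<^sup>2 = 1" using s by (simp add: s_def power_mult_distrib)
  have s1: "\<bar>s\<bar> = 1" using ss by (simp add: power2_eq_1_iff) linarith
  have "d = C\<^sup>2 - 2 * C * c1 * c2 - 1 * s\<^sup>2 - c1\<^sup>2 * s2\<^sup>2 - c2\<^sup>2 * s1\<^sup>2"
    unfolding d_def e_def C(1) s_def by (simp add: power2_eq_square algebra_simps)
  hence "d = (C - c1 * c2)\<^sup>2 - (1 + c1\<^sup>2) * (1 + c2\<^sup>2)"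
    unfolding s ss by (simp add: power2_eq_square algebra_simps)
  hence d: "d > 0" using C(3) by simp
  have "(C - c1 * c2)\<^sup>2 > 1" using C(3)
    using mult_mono[of 1 "1 + c1\<^sup>2" 1 "1 + c2\<^sup>2"] by simp
  hence "C - c1 * c2 > 1"
    using C(2) power_le_one[of "C - c1 * c2" 2] by force
  moreover have "c1 * c2 \<ge> 0" using c by simp
  ultimately have "C > 1" by linarith
  hence Ks: "K - s > 0" using C(1) s1 by (simp add: s_def[symmetric])
  have "(K - s) * x\<^sup>2 - e * x * y + (K - c1 * c2) * y\<^sup>2 \<le> 0"
    using le unfolding s_def e_def by (simp add: power2_eq_square algebra_simps)
  \<comment> \<open>The factor \<open>4 (K - s)\<close> completes the square and leaves
    \<open>d\<close> as the coefficient of \<open>y^2\<close>.\<close>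
  hence "4 * (K - s) * ((K - s) * x\<^sup>2 - e * x * y + (K - c1 * c2) * y\<^sup>2) \<le> 0"
    using Ks by (simp add: mult_le_0_iff)
  hence *: "(2 * (K - s) * x - e * y)\<^sup>2 + d * y\<^sup>2 \<le> 0"
    unfolding d_def by (simp add: power2_eq_square algebra_simps)
  have "d * y\<^sup>2 \<ge> 0" using d by simp
  with * have "d * y\<^sup>2 = 0" "(2 * (K - s) * x - e * y)\<^sup>2 = 0"
    using zero_le_power2[of "2 * (K - s) * x - e * y"] by linarith+
  thus ?thesis using d Ks by simp
qed

section \<open>Angular sectors\<close>

text \<open>The argument of \<open>wedge_val p q z\<close> is the angle at the point fixed by a reflection with
  vector \<open>p\<close>, measured from the direction of the one determined by \<open>q\<close>.\<close>

definition wedge_val :: "complex ^ 3 \<Rightarrow> complex ^ 3 \<Rightarrow> complex ^ 3 \<Rightarrow> complex" where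
  "wedge_val p q z = herm p q * herm z p * cnj (herm z p * herm p q - herm p p * herm z q)"

text \<open>With \<open>c = cot \<alpha>\<close> this is the sector of angle less than
  \<open>\<alpha>\<close> on either side of the direction of \<open>q\<close>, as a cone of
  vectors.\<close>

definition wedge :: "complex ^ 3 \<Rightarrow> complex ^ 3 \<Rightarrow> real \<Rightarrow> (complex ^ 3) set" where
  "wedge p q c = {z. Re (wedge_val p q z) > c * \<bar>Im (wedge_val p q z)\<bar>}"

text \<open>Vectors orthogonal to both \<open>p\<close> and \<open>q\<close> lie in neither wedge,
  so they are removed; otherwise the two complements would always meet.\<close>

definition cowedge :: "complex ^ 3 \<Rightarrow> complex ^ 3 \<Rightarrow> real \<Rightarrow> (complex ^ 3) set" where
  "cowedge p q c = {z. z \<notin> wedge p q c \<and> (herm z p \<noteq> 0 \<or> herm z q \<noteq> 0)}"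

lemma wedge_val_scale: "wedge_val p q (c *s z) = of_real ((cmod c)\<^sup>2) * wedge_val p q z"
  by (simp add: wedge_val_def herm_scale_left complex_norm_square algebra_simps del: of_real_power)

lemma wedge_scale:
  assumes "c \<noteq> 0"
  shows "c *s z \<in> wedge p q t \<longleftrightarrow> z \<in> wedge p q t"
proof -
  have "t * \<bar>Im (wedge_val p q (c *s z))\<bar> = (cmod c)\<^sup>2 * (t * \<bar>Im (wedge_val p q z)\<bar>)"
    by (simp add: wedge_val_scale abs_mult del: of_real_power)
  moreover have "Re (wedge_val p q (c *s z)) = (cmod c)\<^sup>2 * Re (wedge_val p q z)"
    by (simp add: wedge_val_scale del: of_real_power)
  ultimately show ?thesis
    unfolding wedge_def mem_Collect_eq using assms by (simp only:) simp
qed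

lemma cowedge_scale: "c \<noteq> 0 \<Longrightarrow> c *s z \<in> cowedge p q t \<longleftrightarrow> z \<in> cowedge p q t"
  by (simp add: cowedge_def wedge_scale herm_scale_left)

lemma herm_zero [simp]: "herm 0 z = 0" "herm z 0 = 0"
  by (simp_all add: herm_expand)

lemma open_wedge: "open (wedge p q c)"
proof -
  have h: "continuous_on UNIV (\<lambda>z. herm z w)" for w
    unfolding herm_expand by (intro continuous_intros)
  show ?thesis unfolding wedge_def wedge_val_def
    by (intro open_Collect_less continuous_intros h)
qed

text \<open>Lying outside both wedges bounds \<open>K |a|^2\<close> and \<open>K |b|^2\<close> by
  linear forms in \<open>x\<close> and \<open>y\<close>. The product of these bounds, with
  \<open>|W|^2 = K |a|^2 |b|^2\<close>, is the inequality that
  \<open>quadratic_form_anisotropic\<close> allows only at the origin; then \<open>a\<close> and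
  \<open>b\<close> vanish, which a cowedge excludes.\<close>

lemma cowedges_disjoint:
  assumes p: "herm p p = of_real s1" "s1\<^sup>2 = 1" and q: "herm q q = of_real s2" "s2\<^sup>2 = 1"
    and c: "c1 \<ge> 0" "c2 \<ge> 0"
    and C: "C = 2 * (cmod (herm p q))\<^sup>2 - s1 * s2" "C > c1 * c2"
      "(C - c1 * c2)\<^sup>2 > (1 + c1\<^sup>2) * (1 + c2\<^sup>2)"
    and k: "herm p q \<noteq> 0"
  shows "cowedge p q c1 \<inter> cowedge q p c2 = {}"
proof -
  have "herm z p = 0 \<and> herm z q = 0" if z: "z \<notin> wedge p q c1" "z \<notin> wedge q p c2" for z
  proof -
    define a b k K where "a = herm z p" and "b = herm z q" and "k = herm p q" and "K = (cmod k)\<^sup>2"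
    have k': "herm q p = cnj k" by (simp add: k_def herm_cnj)
    have "K > 0" using k by (simp add: K_def k_def)
    define W where "W = a * cnj b * k"
    have 1: "wedge_val p q z = of_real (K * (cmod a)\<^sup>2) - of_real s1 * W"
      unfolding wedge_val_def p W_def K_def of_real_mult complex_norm_square k_def[symmetric]
        a_def[symmetric] b_def[symmetric]
      by (simp add: algebra_simps)
    have 2: "wedge_val q p z = of_real (K * (cmod b)\<^sup>2) - of_real s2 * cnj W"
      unfolding wedge_val_def q W_def K_def of_real_mult complex_norm_square k'
        a_def[symmetric] b_def[symmetric]
      by (simp add: algebra_simps)
    \<comment> \<open>The two wedge values involve \<open>W\<close> and \<open>cnj W\<close>; taking
      \<open>|Im W|\<close> makes both bounds forms in the same pair.\<close>
    define x y where "x = Re W" and "y = \<bar>Im W\<bar>"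
    have s: "\<bar>s1\<bar> = 1" "\<bar>s2\<bar> = 1" using p(2) q(2) by (auto simp: power2_eq_1_iff)
    have le1: "K * (cmod a)\<^sup>2 \<le> s1 * x + c1 * y"
      using z(1) s unfolding wedge_def mem_Collect_eq 1 by (simp add: x_def y_def abs_mult del: of_real_mult)
    have le2: "K * (cmod b)\<^sup>2 \<le> s2 * x + c2 * y"
      using z(2) s unfolding wedge_def mem_Collect_eq 2 by (simp add: x_def y_def abs_mult del: of_real_mult)
    have "x\<^sup>2 + y\<^sup>2 = (cmod W)\<^sup>2" by (simp add: x_def y_def cmod_power2)
    also have "\<dots> = K * (cmod a)\<^sup>2 * (cmod b)\<^sup>2"
      by (simp add: W_def K_def norm_mult power_mult_distrib)
    finally have "x\<^sup>2 + y\<^sup>2 = K * (cmod a)\<^sup>2 * (cmod b)\<^sup>2" .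
    hence "K * (x\<^sup>2 + y\<^sup>2) = (K * (cmod a)\<^sup>2) * (K * (cmod b)\<^sup>2)" by simp
    also have "\<dots> \<le> (s1 * x + c1 * y) * (s2 * x + c2 * y)"
      using le1 le2 \<open>K > 0\<close> by (intro mult_mono) (auto intro: order_trans[rotated])
    finally have "x = 0 \<and> y = 0"
      using quadratic_form_anisotropic[OF p(2) q(2) c, of C K x y] C by (simp add: K_def k_def)
    thus ?thesis using le1 le2 \<open>K > 0\<close> by (simp add: mult_le_0_iff a_def b_def)
  qed
  thus ?thesis by (auto simp: cowedge_def)
qed

lemma cowedge_subset_wedge:
  "cowedge p q c1 \<inter> cowedge q p c2 = {} \<Longrightarrow> cowedge p q c1 \<subseteq> wedge q p c2"
  by (auto simp: cowedge_def)

text \<open>Supplies the base point of the ping-pong: a vector at which both wedge values are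
  positive reals lies in the wedges of every opening.\<close>

lemma wedges_meet:
  assumes p: "herm p p = of_real s1" "s1\<^sup>2 = 1" and q: "herm q q = of_real s2" "s2\<^sup>2 = 1"
    and C: "2 * (cmod (herm p q))\<^sup>2 - s1 * s2 > 1" and k: "herm p q \<noteq> 0"
  shows "\<exists>z. z \<in> wedge p q c1 \<inter> wedge q p c2"
proof -
  define k K where "k = herm p q" and "K = (cmod k)\<^sup>2"
  have k': "herm q p = cnj k" by (simp add: k_def herm_cnj)
  have K: "K > 0" using k by (simp add: K_def k_def)
  have KC: "k * cnj k = of_real K" by (simp add: K_def complex_norm_square del: of_real_power)
  have s: "s1 = 1 \<or> s1 = -1" "s2 = 1 \<or> s2 = -1" using p(2) q(2) by (auto simp: power2_eq_1_iff)
  \<comment> \<open>The Gram determinant of \<open>p\<close> and \<open>q\<close>. If it vanished,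
    then \<open>K = s1 * s2 = 1\<close> and \<open>2 * K - s1 * s2 = 1\<close>.\<close>
  define D where "D = s1 * s2 - K"
  have "s1 * s2 = 1 \<or> s1 * s2 = -1" using s by auto
  moreover have "2 * K - s1 * s2 > 1" using C by (simp add: K_def k_def)
  ultimately have D: "D \<noteq> 0" unfolding D_def using K by linarith
  \<comment> \<open>Solution of the linear system that prescribes \<open>herm z p = 2\<close> and
    \<open>herm z q = - s2 k\<close>; with these values both wedge values become positive.\<close>
  define u v where "u = (2 * s2 + s2 * K) / D" and "v = - of_real (s1 * s2 + 2) * k / of_real D"
  define z where "z = of_real u *s p + v *s q"
  have uD: "u * D = 2 * s2 + s2 * K" and vD: "v * of_real D = - of_real (s1 * s2 + 2) * k"
    using D by (simp_all add: u_def v_def)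
  have "herm z p * of_real D = of_real (u * D) * of_real s1 + v * of_real D * cnj k"
    by (simp add: z_def herm_add_left herm_scale_left p k' algebra_simps)
  also have "\<dots> = of_real ((2 * s2 + s2 * K) * s1 - (s1 * s2 + 2) * K)"
    unfolding uD vD by (simp add: KC mult.assoc) (simp add: algebra_simps)
  also have "(2 * s2 + s2 * K) * s1 - (s1 * s2 + 2) * K = 2 * D" by (simp add: D_def algebra_simps)
  finally have zp: "herm z p = 2" using D by simp
  have "herm z q * of_real D = of_real (u * D) * k + v * of_real D * of_real s2"
    by (simp add: z_def herm_add_left herm_scale_left q k_def[symmetric] algebra_simps)
  also have "\<dots> = k * of_real (2 * s2 + s2 * K - (s1 * s2 + 2) * s2)"
    unfolding uD vD by (simp add: algebra_simps)
  also have "2 * s2 + s2 * K - (s1 * s2 + 2) * s2 = - s2 * D"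
    using q(2) by (simp add: D_def algebra_simps power2_eq_square)
  finally have "herm z q * of_real D = (- of_real s2 * k) * of_real D" by (simp add: mult_ac)
  hence zq: "herm z q = - of_real s2 * k"
    using D by (subst (asm) mult_right_cancel) auto
  have "wedge_val p q z = of_real (K * (4 + 2 * s1 * s2))"
    unfolding wedge_val_def zp zq p k_def[symmetric] of_real_mult KC[symmetric]
    by (simp add: algebra_simps)
  moreover have "wedge_val q p z = of_real (K\<^sup>2 * s2\<^sup>2 + 2 * s2\<^sup>2 * K)"
    unfolding wedge_val_def zp zq q(1) k' of_real_mult of_real_add power2_eq_square KC[symmetric]
    by (simp add: algebra_simps)
  ultimately have "z \<in> wedge p q c1 \<inter> wedge q p c2"
    using K s q(2) by (auto simp: wedge_def intro!: add_pos_pos simp del: of_real_mult of_real_add)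
  thus ?thesis ..
qed

section \<open>Complex reflections in coordinates\<close>

text \<open>The map that multiplies \<open>p\<close> by \<open>\<zeta>\<close> and fixes the
  orthogonal complement of \<open>p\<close>. Positive \<open>p\<close> gives reflections in lines
  and negative \<open>p\<close> reflections in points, so one formula serves all three
  cases.\<close>

definition refl_mat :: "complex ^ 3 \<Rightarrow> complex \<Rightarrow> complex ^ 3 ^ 3" where
  "refl_mat p \<zeta> = matrix (\<lambda>z. z + ((\<zeta> - 1) * herm z p / herm p p) *s p)"

lemma refl_mat_apply: "refl_mat p \<zeta> *v z = z + ((\<zeta> - 1) * herm z p / herm p p) *s p"
proof -
  define k where "k = (\<zeta> - 1) / herm p p"
  have "Vector_Spaces.linear (*s) (*s) (\<lambda>z. z + (k * herm z p) *s p)"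
    by unfold_locales (simp_all add: herm_add_left herm_scale_left vec_eq_iff algebra_simps)
  moreover have "(\<zeta> - 1) * herm z p / herm p p = k * herm z p" for z by (simp add: k_def)
  ultimately have "Vector_Spaces.linear (*s) (*s) (\<lambda>z. z + ((\<zeta> - 1) * herm z p / herm p p) *s p)"
    by (simp only:)
  thus ?thesis unfolding refl_mat_def by (rule matrix_works)
qed

lemma herm_refl_mat_self: "herm p p \<noteq> 0 \<Longrightarrow> herm (refl_mat p \<zeta> *v z) p = \<zeta> * herm z p"
  by (simp add: refl_mat_apply herm_add_left herm_scale_left field_simps)

lemma herm_refl_mat:
  "herm (refl_mat p \<zeta> *v z) q = herm z q + (\<zeta> - 1) * herm z p / herm p p * herm p q"
  by (simp add: refl_mat_apply herm_add_left herm_scale_left)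

lemma refl_mat_1: "refl_mat p 1 = mat 1"
  by (simp add: matrix_eq refl_mat_apply)

lemma refl_mat_mult:
  assumes "herm p p \<noteq> 0"
  shows "refl_mat p \<zeta> ** refl_mat p \<xi> = refl_mat p (\<zeta> * \<xi>)"
  using assms unfolding matrix_eq matrix_vector_mul_assoc[symmetric]
  by (simp add: refl_mat_apply[of p \<zeta>] herm_refl_mat_self)
     (simp add: refl_mat_apply vec_eq_iff field_simps)

lemma refl_mat_in_U21:
  assumes p: "herm p p \<noteq> 0" and \<zeta>: "cmod \<zeta> = 1"
  shows "refl_mat p \<zeta> \<in> carrier U21"
proof -
  have \<zeta>': "\<zeta> * cnj \<zeta> = 1" using \<zeta> by (simp add: complex_norm_square[symmetric])
  have pc: "cnj (herm p p) = herm p p" by (rule herm_cnj)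
  have "herm (refl_mat p \<zeta> *v z) (refl_mat p \<zeta> *v w) = herm z w" for z w
  proof -
    have pw: "herm p w = cnj (herm w p)" by (simp add: herm_cnj)
    have "herm (refl_mat p \<zeta> *v z) (refl_mat p \<zeta> *v w) =
        herm (refl_mat p \<zeta> *v z) w + cnj ((\<zeta> - 1) * herm w p / herm p p) * (\<zeta> * herm z p)"
      unfolding refl_mat_apply[of p \<zeta> w]
      by (simp add: herm_add_right herm_scale_right herm_refl_mat_self p)
    also have "\<dots> = herm z w + (\<zeta> * cnj \<zeta> - 1) * (herm z p * cnj (herm w p) / herm p p)"
      unfolding herm_refl_mat pw using p by (simp add: pc field_simps)
    finally show ?thesis by (simp add: \<zeta>')
  qed
  thus ?thesis by (simp add: U21_def)
qed

text \<open>The conjugated factor is the pairing of \<open><z,p> p - <p,p> z\<close> with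
  \<open>q\<close>. That vector is orthogonal to \<open>p\<close>, hence fixed by the reflection,
  and only the factor \<open><z,p>\<close> is rotated.\<close>

lemma wedge_val_refl_mat:
  assumes "herm p p \<noteq> 0"
  shows "wedge_val p q (refl_mat p \<zeta> *v z) = \<zeta> * wedge_val p q z"
proof -
  have "herm (refl_mat p \<zeta> *v z) p * herm p q - herm p p * herm (refl_mat p \<zeta> *v z) q =
      herm z p * herm p q - herm p p * herm z q"
    unfolding herm_refl_mat herm_refl_mat_self[OF assms] using assms by (simp add: field_simps)
  thus ?thesis unfolding wedge_val_def by (simp add: herm_refl_mat_self assms)
qed

lemma refl_mat_wedge:
  assumes p: "herm p p \<noteq> 0" and m: "m \<ge> 2" and \<zeta>: "\<zeta> ^ m = 1" "\<zeta> \<noteq> 1"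
    and z: "z \<in> wedge p q (cot (pi / real m))"
  shows "refl_mat p \<zeta> *v z \<in> cowedge p q (cot (pi / real m))"
proof -
  have "refl_mat p \<zeta> *v z \<notin> wedge p q (cot (pi / real m))"
    using z sector_rotated_off[OF m \<zeta>] by (simp add: wedge_def wedge_val_refl_mat p)
  moreover have "herm z p \<noteq> 0" using z by (auto simp: wedge_def wedge_val_def)
  moreover have "\<zeta> \<noteq> 0" using \<zeta>(1) m by (auto simp: power_0_left)
  ultimately show ?thesis by (simp add: cowedge_def herm_refl_mat_self p)
qed

lemma exists_orthogonal: "\<exists>z. z \<noteq> 0 \<and> herm z p = 0"
proof (cases "p $ 3 = 0")
  case True
  thus ?thesis
    by (intro exI[of _ "axis 1 1"]) (simp add: herm_expand axis_def vec_eq_iff forall_3)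
next
  case False
  thus ?thesis
    by (intro exI[of _ "vector [cnj (p $ 2), - cnj (p $ 3), 0]"])
       (simp add: herm_expand vec_eq_iff forall_3)
qed

lemma mat_mult_vec: "mat c *v z = c *s (z :: complex ^ 3)"
  by (simp add: matrix_vector_mult_def mat_def vec_eq_iff forall_3 sum_3)

text \<open>A nonzero vector orthogonal to \<open>p\<close> is fixed, so the scalar is 1; evaluating
  at \<open>p\<close> then gives the claim.\<close>

lemma refl_mat_scalar:
  assumes p: "herm p p \<noteq> 0" and "refl_mat p \<zeta> = mat c"
  shows "\<zeta> = 1"
proof -
  have *: "refl_mat p \<zeta> *v z = c *s z" for z using assms(2) by (simp add: mat_mult_vec)
  obtain z where z: "z \<noteq> 0" "herm z p = 0" using exists_orthogonal by blast
  have "z = c *s z" using *[of z] z by (simp add: refl_mat_apply)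
  hence "c = 1" using z(1) by (metis vec.scale_right_imp_eq vec.scale_one)
  with herm_refl_mat_self[OF p, of \<zeta> p] *[of p] p show ?thesis by simp
qed

section \<open>Classes of matrices and their action on vectors\<close>

definition pu_class :: "complex ^ 3 ^ 3 \<Rightarrow> (complex ^ 3 ^ 3) set" where
  "pu_class M = scalars21 #>\<^bsub>U21\<^esub> M"

interpretation PU: group PU21 by (rule group_PU21)
interpretation U: group U21 by (rule group_U21)

lemma pu_class_hom: "group_hom U21 PU21 pu_class"
  using normal.r_coset_hom_Mod[OF normal_scalars21] group_U21 group_PU21
  by (simp add: group_hom_def group_hom_axioms_def PU21_def pu_class_def[abs_def])

interpretation pu: group_hom U21 PU21 pu_class by (rule pu_class_hom)

lemma pu_class_one: "pu_class (mat 1) = \<one>\<^bsub>PU21\<^esub>"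
proof -
  have "\<one>\<^bsub>U21\<^esub> = mat 1" by (simp add: U21_def)
  thus ?thesis using pu.hom_one by (simp only:)
qed

lemma scalar_nonzero: "mat c \<in> carrier U21 \<Longrightarrow> c \<noteq> 0"
proof
  assume "mat c \<in> carrier U21" "c = 0"
  hence "herm (axis 2 1) (axis 2 1) = herm (0 *s axis 2 1) (0 *s axis 2 1)"
    by (simp add: U21_def mat_mult_vec)
  thus False by (simp add: herm_expand axis_def)
qed

lemma pu_class_iff: "N \<in> pu_class M \<longleftrightarrow> (\<exists>c. mat c \<in> carrier U21 \<and> N = mat c ** M)"
  by (auto simp: pu_class_def r_coset_def scalars21_def U21_def)

lemma PU21_elementE:
  assumes "h \<in> carrier PU21"
  obtains M where "M \<in> carrier U21" "h = pu_class M"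
  using assms by (auto simp: PU21_def carrier_FactGroup pu_class_def)

lemma pu_class_eqI:
  assumes "h \<in> carrier PU21" "M \<in> h"
  shows "h = pu_class M" "M \<in> carrier U21"
proof -
  obtain A where A: "A \<in> carrier U21" "h = pu_class A" using assms(1) by (rule PU21_elementE)
  have sub: "subgroup scalars21 U21" using normal_scalars21 by (simp add: normal_def)
  show "M \<in> carrier U21"
    using assms(2) A U.r_coset_subset_G[of scalars21 A] subgroup.subset[OF sub]
    by (auto simp: pu_class_def)
  show "h = pu_class M"
    using U.repr_independence[OF _ A(1) sub] assms(2) A(2) by (auto simp: pu_class_def)
qed

lemma pu_class_mem: "M \<in> carrier U21 \<Longrightarrow> M \<in> pu_class M"
  using pu_class_iff[of M M] U.one_closed by (auto simp: U21_def intro!: exI[of _ 1])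

text \<open>Quantifying over all representatives makes the relation compose directly with the
  product of cosets.\<close>

definition pu_maps :: "(complex ^ 3 ^ 3) set \<Rightarrow> (complex ^ 3) set \<Rightarrow> (complex ^ 3) set \<Rightarrow> bool" where
  "pu_maps h S T \<longleftrightarrow> (\<forall>M\<in>h. \<forall>z\<in>S. M *v z \<in> T)"

lemma pu_maps_mult:
  assumes "pu_maps g T U" "pu_maps h S T"
  shows "pu_maps (g \<otimes>\<^bsub>PU21\<^esub> h) S U"
  using assms unfolding pu_maps_def PU21_def FactGroup_def set_mult_def
  by (auto simp: U21_def matrix_vector_mul_assoc[symmetric])

text \<open>Elements of a finite cyclic group are powers of \<open>f\<close>, represented by
  reflections with multiplier \<open>\<zeta> ^ k\<close>. The \<open>m\<close>-th power is trivial
  in the quotient, hence scalar, so \<open>\<zeta> ^ m = 1\<close> by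
  \<open>refl_mat_scalar\<close>.\<close>

lemma generate_refl_mat:
  assumes p: "herm p p \<noteq> 0" and \<zeta>: "cmod \<zeta> = 1" and f: "f = pu_class (refl_mat p \<zeta>)"
    and m: "PU.ord f = m" "m > 0" and h: "h \<in> generate PU21 {f}" "h \<noteq> \<one>\<^bsub>PU21\<^esub>"
  obtains \<xi> where "\<xi> ^ m = 1" "\<xi> \<noteq> 1" "h = pu_class (refl_mat p \<xi>)"
proof -
  have R: "refl_mat p \<zeta> \<in> carrier U21" by (rule refl_mat_in_U21[OF p \<zeta>])
  have pow: "refl_mat p \<zeta> [^]\<^bsub>U21\<^esub> k = refl_mat p (\<zeta> ^ k)" for k :: nat
    by (induction k) (simp_all add: U21_def refl_mat_1 nat_pow_def refl_mat_mult p mult.commute)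
  have fpow: "f [^]\<^bsub>PU21\<^esub> k = pu_class (refl_mat p (\<zeta> ^ k))" for k :: nat
    unfolding f pu.hom_nat_pow[OF R, symmetric] pow ..
  have fc: "f \<in> carrier PU21" unfolding f using R by simp
  have "pu_class (refl_mat p (\<zeta> ^ m)) = \<one>\<^bsub>PU21\<^esub>"
    using fpow[of m] PU.pow_ord_eq_1[OF fc] m(1) by simp
  moreover have "refl_mat p (\<zeta> ^ m) \<in> carrier U21"
    using refl_mat_in_U21[OF p] \<zeta> by (simp add: norm_power)
  ultimately have "refl_mat p (\<zeta> ^ m) \<in> scalars21"
    using pu_class_mem[of "refl_mat p (\<zeta> ^ m)"] by (simp add: PU21_def FactGroup_def)
  hence "\<zeta> ^ m = 1" using refl_mat_scalar[OF p] by (auto simp: scalars21_def)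
  obtain k :: nat where k: "h = f [^]\<^bsub>PU21\<^esub> k"
    using h(1) PU.generate_pow_nat[OF fc] m by auto
  show thesis
  proof (rule that[of "\<zeta> ^ k"])
    show "(\<zeta> ^ k) ^ m = 1" using \<open>\<zeta> ^ m = 1\<close>
      by (simp add: power_mult[symmetric] mult.commute[of k]) (simp add: power_mult)
    show hk: "h = pu_class (refl_mat p (\<zeta> ^ k))" unfolding k by (rule fpow)
    show "\<zeta> ^ k \<noteq> 1"
    proof
      assume "\<zeta> ^ k = 1"
      thus False using h(2) unfolding hk by (simp only: refl_mat_1 pu_class_one)
    qed
  qed
qed

text \<open>Every representative of \<open>h\<close> is a nonzero scalar times
  \<open>refl_mat p \<xi>\<close>, and cowedges are invariant under such scalars.\<close>

lemma generate_refl_mat_maps: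
  assumes p: "herm p p \<noteq> 0" and \<zeta>: "cmod \<zeta> = 1" and f: "f = pu_class (refl_mat p \<zeta>)"
    and m: "PU.ord f = m" "m \<ge> 2" and h: "h \<in> generate PU21 {f}" "h \<noteq> \<one>\<^bsub>PU21\<^esub>"
  shows "pu_maps h (wedge p q (cot (pi / real m))) (cowedge p q (cot (pi / real m)))"
proof -
  from m have "m > 0" by simp
  from generate_refl_mat[OF p \<zeta> f m(1) this h]
  obtain \<xi> where \<xi>: "\<xi> ^ m = 1" "\<xi> \<noteq> 1" "h = pu_class (refl_mat p \<xi>)" .
  show ?thesis
    using refl_mat_wedge[OF p m(2) \<xi>(1,2)]
    by (auto simp: pu_maps_def \<xi>(3) pu_class_iff matrix_vector_mul_assoc[symmetric] mat_mult_vec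
        cowedge_scale scalar_nonzero)
qed

section \<open>Polar vectors and normal forms of the reflections\<close>

text \<open>The form is semidefinite on the complement of \<open>z\<close>. A nonzero null vector
  \<open>v\<close> there would pair nontrivially with some \<open>w'\<close> in the complement, and
  a suitable \<open>t *s v + w'\<close> would have negative norm.\<close>

lemma herm_orthogonal_pos:
  assumes z: "negative_vec z" and v: "herm v z = 0" "v \<noteq> 0"
  shows "Re (herm v v) > 0"
proof (rule ccontr)
  assume "\<not> ?thesis"
  with herm_orthogonal_nonneg[OF z v(1)] have vv: "herm v v = 0"
    by (simp add: complex_eq_iff herm_self_real)
  obtain w where w: "herm v w \<noteq> 0" using herm_nondegenerate v(2) by blast
  have zz: "herm z z \<noteq> 0" using z by (auto simp: negative_vec_def)
  define w' where "w' = w - (herm w z / herm z z) *s z"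
  have w'z: "herm w' z = 0" using zz by (simp add: w'_def herm_diff_left herm_scale_left)
  have h: "herm v w' = herm v w" by (simp add: w'_def herm_diff_right herm_scale_right v)
  define r where "r = Re (herm w' w')"
  have r: "r \<ge> 0" unfolding r_def by (rule herm_orthogonal_nonneg[OF z w'z])
  \<comment> \<open>Chosen so that the cross terms contribute \<open>-2 (r + 1)\<close>, which
    outweighs the norm \<open>r\<close> of \<open>w'\<close>.\<close>
  define t where "t = - of_real (r + 1) / herm v w"
  define u where "u = t *s v + w'"
  have th: "t * herm v w' = - of_real (r + 1)" using w by (simp add: t_def h)
  have "herm u z = 0" by (simp add: u_def herm_add_left herm_scale_left v w'z)
  hence "Re (herm u u) \<ge> 0" by (rule herm_orthogonal_nonneg[OF z])
  moreover have "herm u u = t * herm v w' + cnj (t * herm v w') + herm w' w'"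
    by (simp add: u_def herm_add_left herm_add_right herm_scale_left herm_scale_right vv herm_cnj)
  hence "Re (herm u u) = - 2 * (r + 1) + r" unfolding th by (simp add: r_def)
  ultimately show False using r by simp
qed

lemma herm_normalize:
  assumes "Re (herm v v) \<noteq> 0"
  obtains r where "r \<noteq> 0" "herm (r *s v) (r *s v) = of_real (sgn (Re (herm v v)))"
proof
  let ?e = "Re (herm v v)" and ?r = "complex_of_real (1 / sqrt \<bar>Re (herm v v)\<bar>)"
  have v: "herm v v = of_real ?e" by (simp add: complex_eq_iff herm_self_real)
  show "?r \<noteq> 0" using assms by simp
  have "herm (?r *s v) (?r *s v) = of_real (1 / sqrt \<bar>?e\<bar> * (1 / sqrt \<bar>?e\<bar>) * ?e)"
    unfolding herm_scale_left herm_scale_right of_real_mult by (subst v) simp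
  also have "1 / sqrt \<bar>?e\<bar> * (1 / sqrt \<bar>?e\<bar>) * ?e = sgn ?e"
    using assms by (simp add: sgn_if)
  finally show "herm (?r *s v) (?r *s v) = of_real (sgn ?e)" .
qed

lemma subspace_orthogonal: "vec.subspace {y. herm y p = 0}"
  by (auto simp: vec.subspace_def herm_add_left herm_scale_left)

lemma unit_eigenvalue:
  assumes A: "A \<in> carrier U21" and v: "A *v v = c *s v" and "Re (herm v v) \<noteq> 0"
  shows "cmod c = 1"
proof -
  have "herm v v = c * cnj c * herm v v"
    using A v by (metis (mono_tags, lifting) U21_def herm_scale_left herm_scale_right
        mem_Collect_eq mult.assoc partial_object.select_convs(1))
  moreover have "herm v v \<noteq> 0" using assms(3) by auto
  ultimately have "c * cnj c = 1" by simp
  hence "(cmod c)\<^sup>2 = 1" by (metis complex_norm_square of_real_eq_1_iff)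
  thus ?thesis by (simp add: power2_eq_1_iff) (smt (verit) norm_ge_zero)
qed

lemma scalar_in_U21:
  assumes "cmod c = 1"
  shows "mat c \<in> carrier U21"
proof -
  have "c * cnj c = 1" using assms complex_norm_square[of c] by simp
  moreover have "herm (mat c *v z) (mat c *v w) = (c * cnj c) * herm z w" for z w
    by (simp add: mat_mult_vec herm_scale_left herm_scale_right)
  ultimately show ?thesis by (simp add: U21_def)
qed

text \<open>Splitting a vector along \<open>p\<close> and its complement shows that \<open>A\<close>
  is the unit scalar \<open>c\<close> times the reflection with multiplier
  \<open>d / c\<close>.\<close>

lemma pu_class_refl_matI:
  assumes f: "f \<in> carrier PU21" "A \<in> f" and p: "herm p p \<noteq> 0" and cd: "cmod c = 1" "cmod d = 1"
    and Ap: "A *v p = d *s p" and A: "\<And>z. herm z p = 0 \<Longrightarrow> A *v z = c *s z"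
  shows "f = pu_class (refl_mat p (d / c))"
proof -
  have c: "c \<noteq> 0" using cd by auto
  have "A *v z = (mat c ** refl_mat p (d / c)) *v z" for z
  proof -
    define t where "t = herm z p / herm p p"
    have "herm (z - t *s p) p = 0" using p by (simp add: t_def herm_diff_left herm_scale_left)
    hence "A *v (z - t *s p) = c *s (z - t *s p)" by (rule A)
    moreover have "A *v z = A *v (z - t *s p) + t *s (A *v p)"
      by (simp add: matrix_vector_mult_diff_distrib vec.scale)
    ultimately have "A *v z = c *s (z - t *s p) + (t * d) *s p"
      by (simp add: Ap)
    also have "\<dots> = c *s (z + ((d / c - 1) * t) *s p)"
      using c by (simp add: vec_eq_iff field_simps)
    finally show ?thesis
      by (simp add: matrix_vector_mul_assoc[symmetric] mat_mult_vec refl_mat_apply t_def)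
  qed
  hence "A = mat c ** refl_mat p (d / c)" by (simp add: matrix_eq)
  hence "A \<in> pu_class (refl_mat p (d / c))"
    using scalar_in_U21[OF cd(1)] by (auto simp: pu_class_iff)
  moreover have "refl_mat p (d / c) \<in> carrier U21"
    using cd by (intro refl_mat_in_U21 p) (simp add: norm_divide)
  ultimately show ?thesis using pu_class_eqI(1) f by (metis pu.hom_closed)
qed

lemma hyp_part_span:
  assumes "negative_vec z" "z \<in> V" "vec.subspace V"
  shows "vec.span {z} \<in> hyp_part V"
  using assms vec.span_minimal[of "{z}" V] by (auto simp: hyp_part_def HC2_def)

text \<open>The image of \<open>A - c\<close> is orthogonal to the eigenspace \<open>V\<close>,
  because \<open>A\<close> is unitary and \<open>|c| = 1\<close>. A nonzero vector in this image is
  positive and normalises to the polar vector \<open>p\<close> of the line.\<close>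

lemma reflection_in_line_polar:
  assumes "reflection_in_line f L"
  obtains p \<zeta> v where "herm p p = 1" "cmod \<zeta> = 1" "f = pu_class (refl_mat p \<zeta>)"
    "L = hyp_part {y. herm y p = 0}" "negative_vec v" "herm v p = 0"
proof -
  from assms obtain A c v where f: "f \<in> carrier PU21" and A: "A \<in> f"
    and dim: "vec.dim (eigenspace A c) = 2"
    and v: "v \<in> eigenspace A c" "negative_vec v" and L: "L = hyp_part (eigenspace A c)"
    unfolding reflection_in_line_def elliptic_def by blast
  define V where "V = eigenspace A c"
  have AU: "A \<in> carrier U21" using pu_class_eqI[OF f A] by simp
  hence AA: "herm (A *v x) (A *v y) = herm x y" for x y by (simp add: U21_def)
  have Vc: "A *v y = c *s y" if "y \<in> V" for y using that by (simp add: V_def eigenspace_def)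
  have c: "cmod c = 1"
    using v by (intro unit_eigenvalue[OF AU, of v]) (auto simp: negative_vec_def eigenspace_def)
  have cc: "c * cnj c = 1" using c complex_norm_square[of c] by simp
  have subV: "vec.subspace V"
    by (auto simp: V_def eigenspace_def vec.subspace_def vec.add vec.scale vec_eq_iff algebra_simps)
  have "V \<noteq> UNIV" using dim by (auto simp: V_def vec_dim_card simp del: vec.dim_UNIV)
  then obtain z where z: "z \<notin> V" by blast
  define p0 where "p0 = A *v z - c *s z"
  have p0: "p0 \<noteq> 0" using z by (simp add: p0_def V_def eigenspace_def)
  have Aorth: "herm (A *v x) y = c * herm x y" if "y \<in> V" for x y
  proof -
    have "cnj c * herm (A *v x) y = herm x y"
      using AA[of x y] Vc[OF that] by (simp add: herm_scale_right)
    hence "c * herm x y = (c * cnj c) * herm (A *v x) y" by (simp add: mult.assoc)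
    thus ?thesis by (simp add: cc)
  qed
  have p0V: "herm p0 y = 0" if "y \<in> V" for y
    by (simp add: p0_def herm_diff_left herm_scale_left Aorth that)
  have pos: "Re (herm p0 p0) > 0"
    using p0 p0V v by (intro herm_orthogonal_pos[of v]) (auto simp: V_def)
  obtain r where r: "r \<noteq> 0" "herm (r *s p0) (r *s p0) = of_real (sgn (Re (herm p0 p0)))"
    using herm_normalize[of p0] pos by auto
  define p where "p = r *s p0"
  have p: "herm p p = 1" using r pos by (simp add: p_def)
  have pV: "herm p y = 0" if "y \<in> V" for y by (simp add: p_def herm_scale_left p0V that)
  hence Vp: "herm y p = 0" if "y \<in> V" for y using that herm_cnj[of p y] by simp
  \<comment> \<open>The complement of \<open>p\<close> misses \<open>p\<close>, so its dimension is
    at most 2 and the inclusion of \<open>V\<close> in it is an equality.\<close>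
  have "vec.dim {y. herm y p = 0} \<noteq> 3"
  proof
    assume "vec.dim {y. herm y p = 0} = 3"
    hence "vec.span {y. herm y p = 0} = UNIV"
      using vec.dim_eq_full[of "{y. herm y p = 0}"] by (simp add: vec.dimension_def card_cart_basis)
    hence "{y. herm y p = 0} = UNIV" using vec.span_eq_iff subspace_orthogonal by metis
    hence "p \<in> {y. herm y p = 0}" by simp
    thus False using p by simp
  qed
  moreover have "vec.dim {y. herm y p = 0} \<le> 3"
    using dim_subset_UNIV_cart_gen[of "{y. herm y p = 0}"] by simp
  ultimately have "vec.dim {y. herm y p = 0} \<le> vec.dim V" using dim by (simp add: V_def)
  hence V: "V = {y. herm y p = 0}"
    using Vp by (intro vec.subspace_dim_equal subV subspace_orthogonal) auto
  define d where "d = herm (A *v p) p"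
  \<comment> \<open>The component of \<open>A *v p\<close> in \<open>V\<close>. It is also
    orthogonal to \<open>V\<close>, so it is null and orthogonal to the negative vector
    \<open>v\<close>, and must vanish.\<close>
  define e where "e = A *v p - d *s p"
  have eV: "e \<in> V" by (simp add: V e_def herm_diff_left herm_scale_left p d_def)
  have eorth: "herm e y = 0" if "y \<in> V" for y
    by (simp add: e_def herm_diff_left herm_scale_left Aorth pV that)
  have "e = 0"
    using herm_orthogonal_pos[OF v(2), of e] eorth[of e] eorth[of v] eV v(1) by (auto simp: V_def)
  hence Ap: "A *v p = d *s p" by (simp add: e_def)
  have d: "cmod d = 1" using unit_eigenvalue[OF AU Ap] p by simp
  have "f = pu_class (refl_mat p (d / c))"
    using p c d Ap Vc V by (intro pu_class_refl_matI[OF f A]) auto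
  moreover have "cmod (d / c) = 1" using c d by (simp add: norm_divide)
  moreover have "L = hyp_part {y. herm y p = 0}" using L V by (simp only: V_def)
  moreover have "herm v p = 0" using v(1) Vp by (simp only: V_def)
  ultimately show thesis using that[OF p _ _ _ v(2)] by blast
qed

lemma span_scale: "(r::complex) \<noteq> 0 \<Longrightarrow> vec.span {r *s v} = vec.span {v}"
  using vec.span_image_scale[of "{v}" "\<lambda>_. r"] by simp

lemma reflection_in_point_polar:
  assumes "reflection_in_point f x"
  obtains u \<zeta> where "herm u u = - 1" "cmod \<zeta> = 1" "f = pu_class (refl_mat u \<zeta>)"
    "x = vec.span {u}" "negative_vec u"
proof -
  from assms obtain A c d u0 p where f: "f \<in> carrier PU21" and A: "A \<in> f"
    and u0: "negative_vec u0" "x = vec.span {u0}" "eigenspace A c = vec.span {u0}"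
    and p: "positive_vec p" "p \<in> eigenspace A d" and E: "eigenspace A d = {v. herm v u0 = 0}"
    unfolding reflection_in_point_def elliptic_def
    by (metis insertI1 vec.span_base)
  have AU: "A \<in> carrier U21" using pu_class_eqI[OF f A] by simp
  obtain r where r: "r \<noteq> 0" "herm (r *s u0) (r *s u0) = of_real (sgn (Re (herm u0 u0)))"
    using herm_normalize[of u0] u0(1) by (auto simp: negative_vec_def)
  define u where "u = r *s u0"
  have u: "herm u u = - 1" using r u0(1) by (simp add: u_def negative_vec_def)
  have xu: "x = vec.span {u}" using u0(2) span_scale[OF r(1), of u0] by (simp add: u_def)
  have "vec.span {u} = eigenspace A c" using u0 xu by simp
  hence "u \<in> eigenspace A c" using vec.span_base[of u "{u}"] by simp
  hence Au: "A *v u = c *s u" by (simp add: eigenspace_def)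
  have c: "cmod c = 1" using unit_eigenvalue[OF AU Au] u by simp
  have d: "cmod d = 1"
    using unit_eigenvalue[OF AU, of p d] p by (auto simp: eigenspace_def positive_vec_def)
  have "A *v z = d *s z" if "herm z u = 0" for z
  proof -
    have "z \<in> eigenspace A d" using that r(1) unfolding E by (simp add: u_def herm_scale_right)
    thus ?thesis by (simp add: eigenspace_def)
  qed
  \<comment> \<open>The negative eigenvector takes the place of the polar vector; dividing by the
    eigenvalue \<open>d\<close> of its complement leaves the multiplier
    \<open>c / d\<close>.\<close>
  hence "f = pu_class (refl_mat u (c / d))"
    using u c d Au by (intro pu_class_refl_matI[OF f A]) auto
  moreover have "cmod (c / d) = 1" using c d by (simp add: norm_divide)
  ultimately show thesis using that[of u "c / d"] u xu by (simp add: negative_vec_def)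
qed

section \<open>The distance between the fixed point sets\<close>

text \<open>A single pair of points bounds the infimum from above, 0 bounds it from below so that
  \<open>cosh\<close> is monotone here, and \<open>cosh r = 2 cosh^2 (r/2) - 1\<close> brings in the
  metric formula with quotient \<open>t\<close>.\<close>

lemma cosh_set_rho_le:
  assumes X: "X \<subseteq> HC2" and Y: "Y \<subseteq> HC2"
    and z: "negative_vec z" "vec.span {z} \<in> X" and w: "negative_vec w" "vec.span {w} \<in> Y"
    and t: "(cmod (herm z w))\<^sup>2 = t * (Re (herm z z) * Re (herm w w))"
  shows "cosh (set_rho X Y) \<le> 2 * t - 1"
proof -
  let ?S = "{rho x y | x y. x \<in> X \<and> y \<in> Y}" and ?r = "rho (vec.span {z}) (vec.span {w})"
  have nonneg: "0 \<le> r" if "r \<in> ?S" for r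
  proof -
    from that obtain x y where "x \<in> HC2" "y \<in> HC2" "r = rho x y" using X Y by blast
    thus ?thesis using rho_span(1) by (auto simp: HC2_def)
  qed
  have mem: "?r \<in> ?S" using z w by blast
  have "set_rho X Y \<le> ?r" unfolding set_rho_def
    using nonneg by (intro cInf_lower mem bdd_belowI[of _ 0])
  moreover have "0 \<le> set_rho X Y" unfolding set_rho_def
    using nonneg mem by (intro cInf_greatest) auto
  ultimately have "cosh (set_rho X Y) \<le> cosh ?r"
    by (subst cosh_real_nonneg_le_iff) auto
  also have "cosh ?r = 2 * (cosh (?r / 2))\<^sup>2 - 1"
    using cosh_double[of "?r / 2"] by (simp add: sinh_square_eq)
  also have "(cosh (?r / 2))\<^sup>2 = t"
  proof -
    have re: "herm v v = of_real (Re (herm v v))" for v by (simp add: complex_eq_iff herm_self_real)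
    have ne: "Re (herm z z) * Re (herm w w) \<noteq> 0" using z w by (simp add: negative_vec_def)
    have "complex_of_real ((cosh (?r / 2))\<^sup>2) = herm z w * herm w z / (herm z z * herm w w)"
      by (rule rho_span(2)[OF z(1) w(1)])
    also have "herm z w * herm w z = of_real ((cmod (herm z w))\<^sup>2)"
      by (metis complex_norm_square herm_cnj)
    also have "herm z z * herm w w = of_real (Re (herm z z) * Re (herm w w))"
      by (metis re of_real_mult)
    also have "of_real ((cmod (herm z w))\<^sup>2) / of_real (Re (herm z z) * Re (herm w w)) = complex_of_real t"
      unfolding t using ne by simp
    finally show ?thesis by (simp only: of_real_eq_iff)
  qed
  finally show ?thesis .
qed

lemma hyp_part_subset: "hyp_part V \<subseteq> HC2"
  by (auto simp: hyp_part_def)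

text \<open>The nearest point to \<open>z\<close> on the line polar to \<open>p\<close> is its orthogonal projection.\<close>

lemma cosh_set_rho_line_le:
  assumes p: "herm p p = 1" and X: "X = hyp_part {y. herm y p = 0}" and Y: "Y \<subseteq> HC2"
    and z: "negative_vec z" "vec.span {z} \<in> Y"
  shows "cosh (set_rho X Y) \<le> 1 + 2 * ((cmod (herm z p))\<^sup>2 / - Re (herm z z))"
proof -
  define h N where "h = herm z p" and "N = Re (herm z z)"
  have N: "N < 0" using z by (simp add: N_def negative_vec_def)
  have zz: "herm z z = of_real N" by (simp add: N_def complex_eq_iff herm_self_real)
  define w where "w = z - h *s p"
  have wp: "herm w p = 0" by (simp add: w_def herm_diff_left herm_scale_left p h_def)
  have wz: "herm w z = of_real (N - (cmod h)\<^sup>2)"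
    unfolding w_def herm_diff_left herm_scale_left zz of_real_diff complex_norm_square
    by (simp add: h_def herm_cnj)
  have ww: "herm w w = of_real (N - (cmod h)\<^sup>2)"
    unfolding wz[symmetric] by (subst (2) w_def) (simp add: herm_diff_right herm_scale_right wp)
  define M where "M = N - (cmod h)\<^sup>2"
  have M: "M < 0" unfolding M_def using N zero_le_power2[of "cmod h"] by linarith
  have neg: "negative_vec w" using M by (simp add: negative_vec_def ww M_def del: of_real_diff)
  have "cosh (set_rho X Y) \<le> 2 * (M / N) - 1"
  proof (rule cosh_set_rho_le[OF _ Y neg _ z])
    show "X \<subseteq> HC2" unfolding X by (rule hyp_part_subset)
    show "vec.span {w} \<in> X"
      unfolding X using neg wp by (intro hyp_part_span subspace_orthogonal) auto
    show "(cmod (herm w z))\<^sup>2 = M / N * (Re (herm w w) * Re (herm z z))"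
      unfolding wz ww zz M_def[symmetric] using N by (simp add: power2_eq_square)
  qed
  also have "\<dots> = 1 + 2 * ((cmod h)\<^sup>2 / - N)" using N by (simp add: M_def field_simps)
  finally show ?thesis by (simp add: h_def N_def)
qed

text \<open>The component \<open>n\<close> of \<open>p\<close> orthogonal to \<open>q\<close> has
  norm \<open>1 - K\<close>, and \<open><z,p> = <z,n>\<close> for \<open>z\<close> on the second
  line. The sign of \<open>1 - K\<close> separates ultraparallel lines, intersecting lines, and
  lines that are asymptotic or equal.\<close>

lemma cosh_set_rho_lines_le:
  assumes p: "herm p p = 1" and q: "herm q q = 1"
    and X: "X = hyp_part {y. herm y p = 0}" and Y: "Y = hyp_part {y. herm y q = 0}"
    and v: "negative_vec v" "herm v q = 0"
  shows "cosh (set_rho X Y) \<le> max 1 (2 * (cmod (herm p q))\<^sup>2 - 1)"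
proof -
  define k K where "k = herm p q" and "K = (cmod k)\<^sup>2"
  define n where "n = p - k *s q"
  have nq: "herm n q = 0" by (simp add: n_def herm_diff_left herm_scale_left q k_def)
  have zn: "herm z p = herm z n" if "herm z q = 0" for z
    by (simp add: n_def herm_diff_right herm_scale_right that)
  have nn: "herm n n = of_real (1 - K)"
    unfolding zn[OF nq, symmetric] of_real_diff K_def complex_norm_square
    by (simp add: n_def herm_diff_left herm_scale_left p k_def herm_cnj)
  have nv: "herm n v = cnj (herm v n)" by (simp add: herm_cnj)
  have le: "cosh (set_rho X Y) \<le> 1 + 2 * ((cmod (herm z n))\<^sup>2 / - Re (herm z z))"
    if "negative_vec z" "herm z q = 0" for z
    using cosh_set_rho_line_le[OF p X, of Y z] that hyp_part_subset subspace_orthogonal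
    by (simp add: Y zn hyp_part_span)
  consider "K > 1" | "K < 1" | "K = 1" by linarith
  thus ?thesis
  proof cases
    case 1
    \<comment> \<open>Here \<open>n\<close> itself represents a point of the second line, the foot
      of the common perpendicular.\<close>
    have "negative_vec n" using 1 by (simp add: negative_vec_def nn del: of_real_diff)
    from le[OF this nq] have "cosh (set_rho X Y) \<le> 1 + 2 * ((1 - K)\<^sup>2 / (K - 1))"
      unfolding nn by (simp del: of_real_diff)
    also have "(1 - K)\<^sup>2 / (K - 1) = K - 1" using 1 by (simp add: power2_eq_square field_simps)
    finally show ?thesis by (simp add: K_def k_def)
  next
    case 2
    \<comment> \<open>Removing the component along the positive vector \<open>n\<close> keeps
      \<open>v\<close> negative and makes it orthogonal to both \<open>p\<close> and
      \<open>q\<close>: the lines meet.\<close>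
    define z where "z = v - (herm v n / of_real (1 - K)) *s n"
    have "complex_of_real (1 - K) \<noteq> 0" using 2 by (simp del: of_real_diff)
    hence z0: "herm z n = 0"
      unfolding z_def herm_diff_left herm_scale_left nn by simp
    have "herm z z = herm z v"
      by (subst (2) z_def) (simp add: herm_diff_right herm_scale_right z0)
    also have "\<dots> = herm v v - of_real ((cmod (herm v n))\<^sup>2 / (1 - K))"
      unfolding of_real_divide complex_norm_square z_def herm_diff_left herm_scale_left nv by simp
    finally have "Re (herm z z) = Re (herm v v) - (cmod (herm v n))\<^sup>2 / (1 - K)"
      by (simp del: of_real_divide)
    moreover have "(cmod (herm v n))\<^sup>2 / (1 - K) \<ge> 0" using 2 by simp
    ultimately have "negative_vec z" using v by (simp add: negative_vec_def)
    moreover have "herm z q = 0" by (simp add: z_def herm_diff_left herm_scale_left nq v)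
    ultimately show ?thesis using le[of z] z0 by simp
  next
    case 3
    define h N where "h = herm v n" and "N = Re (herm v v)"
    have N: "N < 0" using v by (simp add: N_def negative_vec_def)
    have small: "cosh (set_rho X Y) \<le> 1 + 1 / s" if s: "s > 0" for s
    proof -
      \<comment> \<open>A point moving towards the null vector \<open>n\<close>:
        \<open><z,n>\<close> stays equal to \<open>h\<close> while \<open>-<z,z>\<close> becomes
        \<open>2 s |h|^2 - N\<close>, so the bound tends to 1 as \<open>s\<close> grows.\<close>
      define z where "z = v - (of_real s * h) *s n"
      have zn': "herm z n = h" using nn 3 by (simp add: z_def herm_diff_left herm_scale_left h_def)
      have "herm z z = herm v v - of_real (2 * s * (cmod h)\<^sup>2)"
        unfolding z_def herm_diff_left herm_scale_left herm_diff_right herm_scale_right nv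
          h_def[symmetric] of_real_mult complex_norm_square
        using nn 3 by (simp add: algebra_simps)
      hence zz: "Re (herm z z) = N - 2 * s * (cmod h)\<^sup>2" by (simp add: N_def del: of_real_mult)
      moreover have pos: "2 * s * (cmod h)\<^sup>2 \<ge> 0" using s by simp
      ultimately have "negative_vec z" using N by (simp add: negative_vec_def)
      moreover have "herm z q = 0" by (simp add: z_def herm_diff_left herm_scale_left nq v)
      ultimately have "cosh (set_rho X Y) \<le> 1 + 2 * ((cmod h)\<^sup>2 / (2 * s * (cmod h)\<^sup>2 - N))"
        using le[of z] by (simp add: zn' zz)
      also have "(cmod h)\<^sup>2 / (2 * s * (cmod h)\<^sup>2 - N) \<le> 1 / (2 * s)"
      proof -
        have "1 / (2 * s) * (2 * s * (cmod h)\<^sup>2 - N) = (cmod h)\<^sup>2 - N / (2 * s)"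
          using s by (simp add: field_simps)
        moreover have "N / (2 * s) < 0" using N s by (intro divide_neg_pos) auto
        moreover have "0 < 2 * s * (cmod h)\<^sup>2 - N" using N pos by linarith
        ultimately show ?thesis by (subst pos_divide_le_eq) linarith+
      qed
      finally show ?thesis using s by simp
    qed
    have "cosh (set_rho X Y) \<le> 1"
    proof (rule field_le_epsilon)
      fix e :: real assume "e > 0"
      thus "cosh (set_rho X Y) \<le> 1 + e" using small[of "1 / e"] by simp
    qed
    thus ?thesis by simp
  qed
qed

section \<open>Ping-pong\<close>

text \<open>With \<open>x\<close> the preimage of \<open>z\<close> under a representative of
  \<open>h\<close>, the classes with a representative taking \<open>x\<close> into \<open>D\<close>
  form an open set. If such a class \<open>k\<close> lies in \<open>H\<close>, then \<open>k\<close>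
  times the inverse of \<open>h\<close> has a representative taking \<open>z\<close> into
  \<open>D\<close>, hence is trivial; so the open set isolates \<open>h\<close>.\<close>

lemma discrete_in_PU21I:
  assumes H: "subgroup H PU21" and D: "open D" "z \<in> D"
    and maps: "\<And>h. h \<in> H \<Longrightarrow> h \<noteq> \<one>\<^bsub>PU21\<^esub> \<Longrightarrow> pu_maps h D (- D)"
  shows "discrete_in_PU21 H"
proof -
  have sub: "H \<subseteq> carrier PU21" using H by (rule subgroup.subset)
  have "openin (subtopology PU21_topology H) {h}" if h: "h \<in> H" for h
  proof -
    obtain B where B: "B \<in> carrier U21" "h = pu_class B" using PU21_elementE sub h by blast
    define x where "x = inv\<^bsub>U21\<^esub> B *v z"
    define W where "W = {k \<in> carrier PU21. \<exists>A\<in>k. A *v x \<in> D}"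
    have "{A \<in> carrier U21. scalars21 #>\<^bsub>U21\<^esub> A \<in> W} =
        carrier U21 \<inter> (\<Union>c\<in>{c. mat c \<in> carrier U21}. (\<lambda>A. c *s (A *v x)) -` D)"
    proof -
      have "(\<exists>N\<in>pu_class A. N *v x \<in> D) \<longleftrightarrow>
          (\<exists>c. mat c \<in> carrier U21 \<and> c *s (A *v x) \<in> D)" for A
        unfolding Bex_def pu_class_iff by (metis matrix_vector_mul_assoc mat_mult_vec)
      thus ?thesis unfolding W_def pu_class_def[symmetric] by auto
    qed
    moreover have "open ((\<lambda>A :: complex ^ 3 ^ 3. c *s (A *v x)) -` D)" for c
      unfolding matrix_vector_mult_def vector_scalar_mult_def
      by (intro open_vimage D continuous_intros)
    ultimately have "openin PU21_topology W"
      unfolding openin_PU21_topology by (auto simp: W_def openin_open_Int open_UN)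
    moreover have "W \<inter> H = {h}"
    proof (intro subset_antisym subsetI)
      fix k assume "k \<in> {h}"
      have "B *v x = z" using U.r_inv[OF B(1)]
        by (simp add: x_def matrix_vector_mul_assoc) (simp add: U21_def)
      thus "k \<in> W \<inter> H" using \<open>k \<in> {h}\<close> h sub B D pu_class_mem[OF B(1)] by (auto simp: W_def)
    next
      fix k assume k: "k \<in> W \<inter> H"
      then obtain A where A: "A \<in> k" "A *v x \<in> D" and kc: "k \<in> carrier PU21" by (auto simp: W_def)
      have AU: "A \<in> carrier U21" "k = pu_class A" using pu_class_eqI[OF kc A(1)] by auto
      let ?g = "k \<otimes>\<^bsub>PU21\<^esub> inv\<^bsub>PU21\<^esub> h"
      have "?g = pu_class (A \<otimes>\<^bsub>U21\<^esub> inv\<^bsub>U21\<^esub> B)" using AU B by simp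
      hence "A \<otimes>\<^bsub>U21\<^esub> inv\<^bsub>U21\<^esub> B \<in> ?g"
        using pu_class_mem[of "A \<otimes>\<^bsub>U21\<^esub> inv\<^bsub>U21\<^esub> B"] AU(1) B(1)
        by (simp only: U.m_closed U.inv_closed)
      moreover have "(A \<otimes>\<^bsub>U21\<^esub> inv\<^bsub>U21\<^esub> B) *v z = A *v x"
        by (simp add: x_def matrix_vector_mul_assoc) (simp add: U21_def)
      moreover have "?g \<in> H" using k h H by (simp add: subgroup.m_closed subgroup.m_inv_closed)
      ultimately have "?g = \<one>\<^bsub>PU21\<^esub>"
        using maps[of ?g] A(2) D(2) unfolding pu_maps_def by (metis ComplD)
      hence "k = \<one>\<^bsub>PU21\<^esub> \<otimes>\<^bsub>PU21\<^esub> h"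
        using PU.inv_solve_right'[OF PU.one_closed kc, of h] h sub by blast
      hence "k = h" using PU.l_one h sub by auto
      thus "k \<in> {h}" by simp
    qed
    ultimately show ?thesis by (auto simp: openin_subtopology)
  qed
  thus ?thesis using sub unfolding discrete_in_PU21_def
    by (intro sym[OF iffD2[OF discrete_topology_unique]]) (auto simp: topspace_PU21_topology)
qed

text \<open>The signs \<open>s1\<close> and \<open>s2\<close> encode the kinds of the two
  reflections, and the bound on \<open>cosh\<close> has become one on
  \<open>2 |<p,q>|^2 - s1 s2\<close>.\<close>

lemma complex_reflections_free_product:
  assumes p: "herm p p = of_real s1" "s1\<^sup>2 = 1" and q: "herm q q = of_real s2" "s2\<^sup>2 = 1"
    and f: "cmod \<zeta> = 1" "f = pu_class (refl_mat p \<zeta>)" "PU.ord f = m" "m \<ge> 2"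
    and g: "cmod \<omega> = 1" "g = pu_class (refl_mat q \<omega>)" "PU.ord g = n" "n \<ge> 2"
    and C: "2 * (cmod (herm p q))\<^sup>2 - s1 * s2 >
      (cos (pi / real m) * cos (pi / real n) + 1) / (sin (pi / real m) * sin (pi / real n))"
  shows "discrete_in_PU21 (generate PU21 {f, g}) \<and>
         PU21\<lparr>carrier := generate PU21 {f, g}\<rparr> \<cong>
           free_product (PU21\<lparr>carrier := generate PU21 {f}\<rparr>) (PU21\<lparr>carrier := generate PU21 {g}\<rparr>)"
proof -
  define C0 where "C0 = 2 * (cmod (herm p q))\<^sup>2 - s1 * s2"
  define c1 c2 where "c1 = cot (pi / real m)" and "c2 = cot (pi / real n)"
  have ang: "0 < sin (pi / real k) \<and> 0 \<le> cos (pi / real k)" if "k \<ge> 2" for k :: nat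
  proof -
    have "0 < pi / real k" using that by simp
    moreover have "pi / real k \<le> pi / 2" using that by (intro divide_left_mono) auto
    ultimately show ?thesis using pi_gt_zero by (intro conjI sin_gt_zero cos_ge_zero) linarith+
  qed
  define S1 S2 where "S1 = sin (pi / real m)" and "S2 = sin (pi / real n)"
  have S: "S1 > 0" "S2 > 0" using ang f(4) g(4) by (auto simp: S1_def S2_def)
  have c: "c1 \<ge> 0" "c2 \<ge> 0" using ang f(4) g(4) by (auto simp: c1_def c2_def cot_def)
  have csc: "1 + (cot t)\<^sup>2 = 1 / (sin t)\<^sup>2" if "sin t > 0" for t :: real
  proof -
    have "1 + (cot t)\<^sup>2 = ((sin t)\<^sup>2 + (cos t)\<^sup>2) / (sin t)\<^sup>2"
      unfolding add_divide_distrib using that by (simp add: cot_def power_divide)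
    thus ?thesis by simp
  qed
  have c': "1 + c1\<^sup>2 = 1 / S1\<^sup>2" "1 + c2\<^sup>2 = 1 / S2\<^sup>2"
    using csc S by (simp_all add: c1_def c2_def S1_def S2_def)
  \<comment> \<open>The hypothesis divided out. Squared, by \<open>1 + cot^2 = 1 / sin^2\<close>, it
    is the definiteness condition of \<open>quadratic_form_anisotropic\<close>.\<close>
  have gt: "C0 - c1 * c2 > 1 / (S1 * S2)"
    using C S by (simp add: C0_def c1_def c2_def cot_def S1_def S2_def add_divide_distrib)
  moreover have "1 / (S1 * S2) > 0" using S by simp
  ultimately have C1: "C0 > c1 * c2" by linarith
  have "(1 / (S1 * S2))\<^sup>2 < (C0 - c1 * c2)\<^sup>2"
    using gt S by (intro power_strict_mono) auto
  hence C2: "(C0 - c1 * c2)\<^sup>2 > (1 + c1\<^sup>2) * (1 + c2\<^sup>2)"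
    unfolding c' by (simp add: power_divide power_mult_distrib)
  have "S1 * S2 \<le> 1" using S by (intro mult_le_one) (auto simp: S1_def S2_def)
  hence "1 / (S1 * S2) \<ge> 1" using S by simp
  with gt c have C3: "C0 > 1" by (smt (verit) mult_nonneg_nonneg)
  \<comment> \<open>Orthogonal \<open>p\<close> and \<open>q\<close> would give
    \<open>C0 = - s1 s2\<close>, at most 1.\<close>
  have k: "herm p q \<noteq> 0"
  proof
    assume "herm p q = 0"
    hence "C0 = - (s1 * s2)" by (simp add: C0_def)
    moreover have "\<bar>s1 * s2\<bar> = 1" using p(2) q(2) by (auto simp: power2_eq_1_iff abs_mult)
    ultimately show False using C3 by linarith
  qed
  have p0: "herm p p \<noteq> 0" and q0: "herm q q \<noteq> 0" using p q by auto
  define XA XB where "XA = cowedge p q c1" and "XB = cowedge q p c2"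
  define DA DB where "DA = wedge p q c1" and "DB = wedge q p c2"
  have disj: "XA \<inter> XB = {}"
    unfolding XA_def XB_def using cowedges_disjoint[OF p q c C0_def C1 C2 k] .
  have XA: "XA \<subseteq> DB" unfolding XA_def DB_def
    using disj by (intro cowedge_subset_wedge) (simp add: XA_def XB_def)
  have XB: "XB \<subseteq> DA" unfolding XB_def DA_def
    using disj by (intro cowedge_subset_wedge) (simp add: XA_def XB_def Int_commute)
  have XD: "XA \<subseteq> - (DA \<inter> DB)" "XB \<subseteq> - (DA \<inter> DB)"
    by (auto simp: XA_def XB_def DA_def DB_def cowedge_def)
  obtain z where z: "z \<in> DA \<inter> DB"
    using wedges_meet[OF p q _ k] C3 by (auto simp: C0_def DA_def DB_def)
  have openD: "open (DA \<inter> DB)" by (auto simp: DA_def DB_def open_wedge)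
  have fg: "f \<in> carrier PU21" "g \<in> carrier PU21"
    using refl_mat_in_U21 p0 q0 f g by auto
  let ?A = "generate PU21 {f}" and ?B = "generate PU21 {g}"
  have A: "subgroup ?A PU21" and B: "subgroup ?B PU21" and AB: "subgroup (generate PU21 {f, g}) PU21"
    using fg by (auto intro!: PU.generate_is_subgroup)
  have gen: "generate PU21 (?A \<union> ?B) = generate PU21 {f, g}"
  proof (intro subset_antisym)
    have "?A \<subseteq> generate PU21 {f, g}" "?B \<subseteq> generate PU21 {f, g}"
      by (intro PU.mono_generate; simp)+
    thus "generate PU21 (?A \<union> ?B) \<subseteq> generate PU21 {f, g}"
      by (intro PU.generate_subgroup_incl AB) auto
    show "generate PU21 {f, g} \<subseteq> generate PU21 (?A \<union> ?B)"
      by (intro PU.mono_generate) (auto intro: generate.incl)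
  qed
  let ?GA = "PU21\<lparr>carrier := ?A\<rparr>" and ?GB = "PU21\<lparr>carrier := ?B\<rparr>"
  \<comment> \<open>Used twice: the nonempty region \<open>DA \<inter> DB\<close> shows that the
    word is not trivial, and its openness gives discreteness.\<close>
  have word: "pu_maps (fp_eval PU21 w) (DA \<inter> DB) (- (DA \<inter> DB))"
    if w: "w \<in> fp_words ?GA ?GB" "fp_reduced ?GA ?GB w" "w \<noteq> []" for w
  proof -
    have "pu_maps (fp_eval PU21 w) (DA \<inter> DB) (if isl (hd w) then XA else XB)"
    proof (rule ping_pong_reduced[where moves = pu_maps, OF group_PU21 A B pu_maps_mult _ _ _ XB XA w])
      show "pu_maps a DA XA" if "a \<in> ?A" "a \<noteq> \<one>\<^bsub>PU21\<^esub>" for a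
        unfolding DA_def XA_def c1_def by (rule generate_refl_mat_maps[OF p0 f that])
      show "pu_maps a DB XB" if "a \<in> ?B" "a \<noteq> \<one>\<^bsub>PU21\<^esub>" for a
        unfolding DB_def XB_def c2_def by (rule generate_refl_mat_maps[OF q0 g that])
    qed (auto simp: pu_maps_def)
    moreover have "(if isl (hd w) then XA else XB) \<subseteq> - (DA \<inter> DB)" using XD by simp
    ultimately show ?thesis unfolding pu_maps_def by blast
  qed
  have word1: "fp_eval PU21 w \<noteq> \<one>\<^bsub>PU21\<^esub>"
    if w: "w \<in> fp_words ?GA ?GB" "fp_reduced ?GA ?GB w" "w \<noteq> []" for w
  proof
    assume "fp_eval PU21 w = \<one>\<^bsub>PU21\<^esub>"
    hence "fp_eval PU21 w = pu_class (mat 1)" using pu_class_one by simp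
    moreover have "mat 1 \<in> carrier U21" using U.one_closed by (simp add: U21_def)
    ultimately have "mat 1 \<in> fp_eval PU21 w" using pu_class_mem by simp
    with word[OF w] z have "mat 1 *v z \<in> - (DA \<inter> DB)" unfolding pu_maps_def by blast
    thus False using z by simp
  qed
  have "discrete_in_PU21 (generate PU21 {f, g})"
  proof (rule discrete_in_PU21I[OF AB openD z])
    fix h assume h: "h \<in> generate PU21 {f, g}" "h \<noteq> \<one>\<^bsub>PU21\<^esub>"
    hence "h \<in> generate PU21 (?A \<union> ?B)" using gen by simp
    from generate_Un_fp_eval_reduced[OF group_PU21 A B this]
    obtain w where w: "w \<in> fp_words ?GA ?GB" "fp_reduced ?GA ?GB w" "h = fp_eval PU21 w" .
    with h(2) have "w \<noteq> []" by auto
    with w word show "pu_maps h (DA \<inter> DB) (- (DA \<inter> DB))" by simp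
  qed
  moreover have "PU21\<lparr>carrier := generate PU21 (?A \<union> ?B)\<rparr> \<cong> free_product ?GA ?GB"
    by (rule free_product_iso[OF group_PU21 A B word1])
  ultimately show ?thesis unfolding gen by simp
qed

theorem theorem3:
  fixes f g :: "(complex ^ 3 ^ 3) set" and m n :: nat and X Y :: "point set"
  assumes "elliptic f" and "elliptic g"
    and "m > 0" and "group.ord PU21 f = m"
    and "n > 0" and "group.ord PU21 g = n"
    and "(reflection_in_line f X \<and> reflection_in_line g Y) \<or>
         (reflection_in_line f X \<and> (\<exists>y. reflection_in_point g y \<and> Y = {y})) \<or>
         ((\<exists>x. reflection_in_point f x \<and> X = {x}) \<and> (\<exists>y. reflection_in_point g y \<and> Y = {y}))"
    and "cosh (set_rho X Y) >
           (cos (pi / real m) * cos (pi / real n) + 1) / (sin (pi / real m) * sin (pi / real n))"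
  shows "discrete_in_PU21 (generate PU21 {f, g}) \<and>
         PU21\<lparr>carrier := generate PU21 {f, g}\<rparr> \<cong>
           free_product (PU21\<lparr>carrier := generate PU21 {f}\<rparr>) (PU21\<lparr>carrier := generate PU21 {g}\<rparr>)"
proof -
  define T where "T = (cos (pi / real m) * cos (pi / real n) + 1) / (sin (pi / real m) * sin (pi / real n))"
  have T: "cosh (set_rho X Y) > T" using assms(8) by (simp add: T_def)
  have fg: "f \<in> carrier PU21" "g \<in> carrier PU21" using assms(1,2) by (auto simp: elliptic_def)
  have "f \<noteq> \<one>\<^bsub>PU21\<^esub>" "g \<noteq> \<one>\<^bsub>PU21\<^esub>"
    using assms(7) by (auto simp: reflection_in_line_def reflection_in_point_def)
  hence "m \<noteq> 1" "n \<noteq> 1" using PU.ord_eq_1 fg assms(4,6) by metis+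
  hence mn: "m \<ge> 2" "n \<ge> 2" using assms(3,5) by auto
  \<comment> \<open>Equivalent to \<open>cos (pi/m + pi/n) \<ge> -1\<close>. For two lines it rules
    out the value 1 of the maximum in \<open>cosh_set_rho_lines_le\<close>.\<close>
  have "T \<ge> 1"
  proof -
    have "sin (pi / real k) > 0" if "k \<ge> 2" for k :: nat
      using that by (auto intro!: sin_gt_zero simp: field_simps)
    hence "sin (pi / real m) * sin (pi / real n) > 0" using mn by simp
    moreover have "cos (pi / real m + pi / real n) \<ge> - 1" by (rule cos_ge_minus_one)
    ultimately show ?thesis by (simp add: T_def cos_add)
  qed
  note main = complex_reflections_free_product[where f = f and g = g and m = m and n = n,
      folded T_def]
  from assms(7) consider (ll) "reflection_in_line f X" "reflection_in_line g Y"
    | (lp) y where "reflection_in_line f X" "reflection_in_point g y" "Y = {y}"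
    | (pp) x y where "reflection_in_point f x" "X = {x}" "reflection_in_point g y" "Y = {y}"
    by blast
  thus ?thesis
  proof cases
    case ll
    obtain p \<zeta> v where p: "herm p p = 1" "cmod \<zeta> = 1" "f = pu_class (refl_mat p \<zeta>)"
      "X = hyp_part {y. herm y p = 0}" using ll(1) by (rule reflection_in_line_polar)
    obtain q \<omega> v where q: "herm q q = 1" "cmod \<omega> = 1" "g = pu_class (refl_mat q \<omega>)"
      "Y = hyp_part {y. herm y q = 0}" "negative_vec v" "herm v q = 0"
      using ll(2) by (rule reflection_in_line_polar)
    have "T < 2 * (cmod (herm p q))\<^sup>2 - 1 * 1"
      using cosh_set_rho_lines_le[OF p(1) q(1) p(4) q(4-6)] T \<open>T \<ge> 1\<close> by simp
    thus ?thesis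
      using p q mn assms(4,6) by (intro main[of p 1 q 1 \<zeta> \<omega>]) auto
  next
    case lp
    obtain p \<zeta> v where p: "herm p p = 1" "cmod \<zeta> = 1" "f = pu_class (refl_mat p \<zeta>)"
      "X = hyp_part {y. herm y p = 0}" using lp(1) by (rule reflection_in_line_polar)
    obtain u \<omega> where u: "herm u u = - 1" "cmod \<omega> = 1" "g = pu_class (refl_mat u \<omega>)"
      "y = vec.span {u}" "negative_vec u"
      using lp(2) by (rule reflection_in_point_polar)
    have "Y \<subseteq> HC2" using u lp(3) by (auto simp: HC2_def)
    from cosh_set_rho_line_le[OF p(1,4) this u(5)]
    have "cosh (set_rho X Y) \<le> 1 + 2 * (cmod (herm u p))\<^sup>2"
      using u lp(3) by simp
    also have "cmod (herm u p) = cmod (herm p u)" by (metis herm_cnj complex_mod_cnj)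
    finally have "T < 2 * (cmod (herm p u))\<^sup>2 - 1 * (- 1)" using T by simp
    thus ?thesis
      using p u mn assms(4,6) by (intro main[of p 1 u "- 1" \<zeta> \<omega>]) auto
  next
    case pp
    obtain v \<zeta> where v: "herm v v = - 1" "cmod \<zeta> = 1" "f = pu_class (refl_mat v \<zeta>)"
      "x = vec.span {v}" "negative_vec v"
      using pp(1) by (rule reflection_in_point_polar)
    obtain u \<omega> where u: "herm u u = - 1" "cmod \<omega> = 1" "g = pu_class (refl_mat u \<omega>)"
      "y = vec.span {u}" "negative_vec u"
      using pp(3) by (rule reflection_in_point_polar)
    have "X \<subseteq> HC2" "Y \<subseteq> HC2" using u v pp by (auto simp: HC2_def)
    from cosh_set_rho_le[OF this v(5) _ u(5), of "(cmod (herm v u))\<^sup>2"]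
    have "cosh (set_rho X Y) \<le> 2 * (cmod (herm v u))\<^sup>2 - 1"
      using u v pp by simp
    hence "T < 2 * (cmod (herm v u))\<^sup>2 - (- 1) * (- 1)" using T by simp
    thus ?thesis
      using v u mn assms(4,6) by (intro main[of v "- 1" u "- 1" \<zeta> \<omega>]) auto
  qed
qed

end
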